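(* Let $n\ge 1$, let $P(x_1,\dots,x_n)$ be a symmetric polynomial with rational coefficients, and let $$Q(x_1,\dots,x_n)= \frac{\prod_{1\le i\ne j \le n}\left(1-\frac{x_i}{x_j}\right)P(x_1^{-1},\dots, x_n^{-1})}{\prod_{i=1}^n (1-x_i) \prod_{1\le i<j\le n} (1-x_ix_j) }.$$ (i) If $n=2k$, then $$\mathrm{CT}_x\, Q(x)=\frac{(2k)!}{2^k}\,\mathrm{CT}_x\, P(x_1,\dots,x_k,x_{1}^{-1},\dots,x_k^{-1})\,\bar{B}_k(x)\prod_{i=1}^k(x_i^{i}+x_i^{1-i})$$ $$=(2k-1)!!\,\mathrm{CT}_x\, P(x_1,\dots,x_k,x_{1}^{-1},\dots,x_k^{-1})\,\bar{B}_k(x)^2\prod_{i=1}^k x_i .$$ (ii) If $n=2k+1$, then $$\mathrm{CT}_x\, Q(x)=\frac{(2k+1)!}{(-2)^k}\,\mathrm{CT}_x\, P(x_1,\dots,x_k,x_{1}^{-1},\dots,x_k^{-1},1)\, B_k(x)\prod_{i=1}^k (x_i^{-i}-x_i^i)$$ $$=(-1)^k(2k+1)!!\,\mathrm{CT}_x\, P(x_1,\dots,x_k,x_{1}^{-1},\dots,x_k^{-1},1)\, B_k(x)^2 .$$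
   Context: All rational functions are viewed in the ring $\mathbb{Q}((x_1,\dots,x_n))$ of formal Laurent series; that is, $\frac{1}{1-x_i}$ and $\frac{1}{1-x_ix_j}$ are expanded as power series in the $x$'s. $\mathrm{CT}_{x}$ denotes the constant term in all variables $x_1,x_2,\dots$ (the coefficient of the monomial in which every variable has exponent $0$); $\mathrm{CT}_{x_i}F=F$ if $F$ is free of $x_i$. The product over $1\le i\ne j\le n$ runs over all ordered pairs $(i,j)$ with $i\neq j$. Define $$B_k(x)=\det\left(x_i^{-j}-x_i^{j}\right)_{1\le i,j\le k},\qquad \bar{B}_k(x)=\det\left(x_i^{j-1}+x_i^{-j}\right)_{1\le i,j\le k}.$$ An empty determinant equals $1$. Double factorials: $(2k-1)!!=(2k-1)(2k-3)\cdots 1$ and $(2k+1)!!=(2k+1)(2k-1)\cdots 1$. *)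

theory Defs
  imports "HOL-Library.Poly_Mapping" "Jordan_Normal_Form.Determinant"
begin

section \<open>Formal Laurent series in several variables\<close>

text \<open>
  A monomial $\prod_i x_i^{e_i}$ is encoded by its exponent vector \<open>e\<close>, a finitely supported
  function from variable indices to integers.  A series of type \<open>'a laurent\<close> involves only finitely
  many variables and its exponents are bounded from below, so the type is the union over \<open>N\<close> of
  the rings $R((x_0,\dots,x_N))$.
\<close>

definition laurent_bounded :: "nat \<Rightarrow> ((nat \<Rightarrow>\<^sub>0 int) \<Rightarrow> 'a::zero) \<Rightarrow> bool" where
  "laurent_bounded N f \<longleftrightarrow>
     (\<forall>e. f e \<noteq> 0 \<longrightarrow> Poly_Mapping.keys e \<subseteq> {..N} \<and> (\<forall>i. Poly_Mapping.lookup e i \<ge> - int N))"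

typedef (overloaded) 'a laurent = "{f :: (nat \<Rightarrow>\<^sub>0 int) \<Rightarrow> 'a::zero. \<exists>N. laurent_bounded N f}"
  morphisms coeff_laurent Abs_laurent
  by (rule exI[of _ "\<lambda>_. 0"]) (simp add: laurent_bounded_def)

setup_lifting type_definition_laurent
lifting_forget poly_mapping.lifting

lemma laurent_eqI: "(\<And>e. coeff_laurent f e = coeff_laurent g e) \<Longrightarrow> f = g"
  by (simp add: coeff_laurent_inject[symmetric] fun_eq_iff)

lemma laurent_bounded_mono: "laurent_bounded M f \<Longrightarrow> M \<le> N \<Longrightarrow> laurent_bounded N f"
proof -
  assume f: "laurent_bounded M f" and MN: "M \<le> N"
  have "Poly_Mapping.keys e \<subseteq> {..N} \<and> (\<forall>i. - int N \<le> Poly_Mapping.lookup e i)" if "f e \<noteq> 0" for e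
  proof
    have "Poly_Mapping.keys e \<subseteq> {..M}" and l: "\<And>i. - int M \<le> Poly_Mapping.lookup e i"
      using f that by (auto simp: laurent_bounded_def)
    then show "Poly_Mapping.keys e \<subseteq> {..N}" using MN by (meson atMost_subset_iff order_trans)
    have "- int N \<le> - int M" using MN by simp
    then show "\<forall>i. - int N \<le> Poly_Mapping.lookup e i" using l order_trans by blast
  qed
  then show ?thesis unfolding laurent_bounded_def by blast
qed

lemma obtain_common_bound:
  assumes "\<exists>N. laurent_bounded N f" "\<exists>N. laurent_bounded N g"
  obtains N where "laurent_bounded N f" "laurent_bounded N g"
  using assms by (metis laurent_bounded_mono max.cobounded1 max.cobounded2)

lemma finite_exponent_box:
  "finite {a :: nat \<Rightarrow>\<^sub>0 int. Poly_Mapping.keys a \<subseteq> {..N} \<and>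
     (\<forall>i\<in>{..N}. Poly_Mapping.lookup a i \<in> {l..u i})}" (is "finite ?S")
proof (rule finite_imageD)
  let ?F = "{f :: nat \<Rightarrow> int. \<forall>i. (i \<in> {..N} \<longrightarrow> f i \<in> {l..Max (u ` {..N})}) \<and> (i \<notin> {..N} \<longrightarrow> f i = 0)}"
  have "finite ?F" by (rule finite_set_of_finite_funs) auto
  moreover have "Poly_Mapping.lookup ` ?S \<subseteq> ?F"
  proof clarify
    fix a i assume k: "Poly_Mapping.keys a \<subseteq> {..N}"
      and b: "\<forall>i\<in>{..N}. Poly_Mapping.lookup a i \<in> {l..u i}"
    have u: "u i \<le> Max (u ` {..N})" if "i \<le> N" using that by (intro Max_ge) auto
    show "(i \<in> {..N} \<longrightarrow> Poly_Mapping.lookup a i \<in> {l..Max (u ` {..N})}) \<and>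
        (i \<notin> {..N} \<longrightarrow> Poly_Mapping.lookup a i = 0)"
    proof (cases "i \<le> N")
      case True
      then have "l \<le> Poly_Mapping.lookup a i" "Poly_Mapping.lookup a i \<le> u i" using b by auto
      then show ?thesis using True order_trans[OF _ u[OF True]] by simp
    next
      case False
      then have "i \<notin> Poly_Mapping.keys a" using k by auto
      then show ?thesis using False by (simp add: in_keys_iff)
    qed
  qed
  ultimately show "finite (Poly_Mapping.lookup ` ?S)" by (rule finite_subset[rotated])
  show "inj_on Poly_Mapping.lookup ?S" by (rule inj_onI) (simp only: lookup_inject)
qed

lemma finite_conv_support:
  assumes "\<exists>N. laurent_bounded N f" "\<exists>N. laurent_bounded N g"
  shows "finite {a. f a \<noteq> 0 \<and> g (e - a) \<noteq> 0}"
proof -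
  obtain N where N: "laurent_bounded N f" "laurent_bounded N g"
    using obtain_common_bound[OF assms] .
  have "{a. f a \<noteq> 0 \<and> g (e - a) \<noteq> 0} \<subseteq> {a. Poly_Mapping.keys a \<subseteq> {..N} \<and>
     (\<forall>i\<in>{..N}. Poly_Mapping.lookup a i \<in> {- int N..Poly_Mapping.lookup e i + int N})}"
  proof clarify
    fix a assume fa: "f a \<noteq> 0" and gb: "g (e - a) \<noteq> 0"
    have "Poly_Mapping.lookup e i - Poly_Mapping.lookup a i \<ge> - int N" for i
      using N(2) gb by (metis laurent_bounded_def lookup_minus)
    moreover have "Poly_Mapping.lookup a i \<ge> - int N" for i
      using N(1) fa by (metis laurent_bounded_def)
    moreover have "Poly_Mapping.keys a \<subseteq> {..N}"
      using N(1) fa by (metis laurent_bounded_def)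
    ultimately show "Poly_Mapping.keys a \<subseteq> {..N} \<and>
       (\<forall>i\<in>{..N}. Poly_Mapping.lookup a i \<in> {- int N..Poly_Mapping.lookup e i + int N})"
      by (auto simp: algebra_simps)
  qed
  then show ?thesis by (rule finite_subset[OF _ finite_exponent_box])
qed

lemma keys_add_subset:
  fixes a b :: "nat \<Rightarrow>\<^sub>0 int"
  assumes "Poly_Mapping.keys a \<subseteq> A" "Poly_Mapping.keys b \<subseteq> A"
  shows "Poly_Mapping.keys (a + b) \<subseteq> A"
  using Poly_Mapping.keys_add[of a b] assms by blast

instantiation laurent :: (zero) zero
begin
lift_definition zero_laurent :: "'a laurent" is "\<lambda>_. 0"
  by (simp add: laurent_bounded_def)
instance ..
end

lift_definition monom_laurent :: "'a::zero \<Rightarrow> (nat \<Rightarrow>\<^sub>0 int) \<Rightarrow> 'a laurent"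
  is "\<lambda>c e e'. if e' = e then c else 0"
proof -
  fix c :: 'a and e :: "nat \<Rightarrow>\<^sub>0 int"
  define M where "M = Max (insert 0 (Poly_Mapping.keys e))"
  define L where "L = Max (insert 0 ((\<lambda>i. nat \<bar>Poly_Mapping.lookup e i\<bar>) ` Poly_Mapping.keys e))"
  have 1: "Poly_Mapping.keys e \<subseteq> {..M}"
    unfolding M_def by (intro subsetI atMost_iff[THEN iffD2] Max_ge) simp_all
  have 2: "Poly_Mapping.lookup e i \<ge> - int L" for i
  proof (cases "i \<in> Poly_Mapping.keys e")
    case True
    then have "nat \<bar>Poly_Mapping.lookup e i\<bar> \<le> L"
      unfolding L_def by (intro Max_ge) auto
    then show ?thesis by linarith
  qed (simp add: in_keys_iff)
  have "laurent_bounded (max M L) (\<lambda>e'. if e' = e then c else 0)"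
    unfolding laurent_bounded_def
  proof (intro allI impI)
    fix e' assume "(if e' = e then c else 0) \<noteq> 0"
    then have "e' = e" by presburger
    moreover have "Poly_Mapping.lookup e i \<ge> - int (max M L)" for i
      using 2[of i] by (auto simp: max_def)
    moreover have "Poly_Mapping.keys e \<subseteq> {..max M L}" using 1 by fastforce
    ultimately show "Poly_Mapping.keys e' \<subseteq> {..max M L} \<and>
        (\<forall>i. - int (max M L) \<le> Poly_Mapping.lookup e' i)" by blast
  qed
  then show "\<exists>N. laurent_bounded N (\<lambda>e'. if e' = e then c else 0)" by blast
qed

definition const_laurent :: "'a::zero \<Rightarrow> 'a laurent" where
  "const_laurent c = monom_laurent c 0"

definition var :: "nat \<Rightarrow> 'a::zero_neq_one laurent" where
  "var i = monom_laurent 1 (Poly_Mapping.single i 1)"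

definition CT :: "'a::zero laurent \<Rightarrow> 'a" where
  "CT f = coeff_laurent f 0"

instantiation laurent :: (zero_neq_one) one
begin
definition one_laurent :: "'a laurent" where "one_laurent = monom_laurent 1 0"
instance ..
end

instantiation laurent :: (comm_ring_1) "{plus,minus,uminus,times}"
begin

lift_definition plus_laurent :: "'a laurent \<Rightarrow> 'a laurent \<Rightarrow> 'a laurent" is "\<lambda>f g e. f e + g e"
proof -
  fix f g :: "(nat \<Rightarrow>\<^sub>0 int) \<Rightarrow> 'a"
  assume "\<exists>N. laurent_bounded N f" "\<exists>N. laurent_bounded N g"
  then obtain N where "laurent_bounded N f" "laurent_bounded N g" by (rule obtain_common_bound)
  then have "laurent_bounded N (\<lambda>e. f e + g e)"
    unfolding laurent_bounded_def by (metis add_0)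
  then show "\<exists>N. laurent_bounded N (\<lambda>e. f e + g e)" by blast
qed

lift_definition uminus_laurent :: "'a laurent \<Rightarrow> 'a laurent" is "\<lambda>f e. - f e"
  by (simp add: laurent_bounded_def)

definition minus_laurent :: "'a laurent \<Rightarrow> 'a laurent \<Rightarrow> 'a laurent" where
  "minus_laurent f g = f + - g"

lift_definition times_laurent :: "'a laurent \<Rightarrow> 'a laurent \<Rightarrow> 'a laurent"
  is "\<lambda>f g e. \<Sum>a | f a \<noteq> 0 \<and> g (e - a) \<noteq> 0. f a * g (e - a)"
proof -
  fix f g :: "(nat \<Rightarrow>\<^sub>0 int) \<Rightarrow> 'a"
  assume "\<exists>N. laurent_bounded N f" "\<exists>N. laurent_bounded N g"
  then obtain N where N: "laurent_bounded N f" "laurent_bounded N g" by (rule obtain_common_bound)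
  have "laurent_bounded (2 * N) (\<lambda>e. \<Sum>a | f a \<noteq> 0 \<and> g (e - a) \<noteq> 0. f a * g (e - a))"
    unfolding laurent_bounded_def
  proof (intro allI impI)
    fix e assume "(\<Sum>a | f a \<noteq> 0 \<and> g (e - a) \<noteq> 0. f a * g (e - a)) \<noteq> 0"
    then obtain a where a: "f a \<noteq> 0" "g (e - a) \<noteq> 0"
      by (auto elim: sum.not_neutral_contains_not_neutral)
    have ka: "Poly_Mapping.keys a \<subseteq> {..N}" and kb: "Poly_Mapping.keys (e - a) \<subseteq> {..N}"
      using N a by (auto simp: laurent_bounded_def)
    have "Poly_Mapping.keys (a + (e - a)) \<subseteq> {..N}"
      using ka kb by (rule keys_add_subset)
    then have "Poly_Mapping.keys e \<subseteq> {..2 * N}" by auto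
    moreover have "Poly_Mapping.lookup e i \<ge> - int (2 * N)" for i
    proof -
      have "Poly_Mapping.lookup a i \<ge> - int N" "Poly_Mapping.lookup (e - a) i \<ge> - int N"
        using N a by (auto simp: laurent_bounded_def)
      then show ?thesis by (simp add: lookup_minus)
    qed
    ultimately show "Poly_Mapping.keys e \<subseteq> {..2 * N} \<and>
        (\<forall>i. - int (2 * N) \<le> Poly_Mapping.lookup e i)" by blast
  qed
  then show "\<exists>N. laurent_bounded N (\<lambda>e. \<Sum>a | f a \<noteq> 0 \<and> g (e - a) \<noteq> 0. f a * g (e - a))" by blast
qed

instance ..
end

lemma coeff_times_eq:
  fixes f g :: "'a::comm_ring_1 laurent"
  assumes "finite S" "{a. coeff_laurent f a \<noteq> 0 \<and> coeff_laurent g (e - a) \<noteq> 0} \<subseteq> S"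
  shows "coeff_laurent (f * g) e = (\<Sum>a\<in>S. coeff_laurent f a * coeff_laurent g (e - a))"
  unfolding times_laurent.rep_eq
  by (rule sum.mono_neutral_left) (use assms in auto)

lemma bounded_coeff_laurent: "\<exists>N. laurent_bounded N (coeff_laurent f)"
  using coeff_laurent by auto

lemma finite_times_support:
  "finite {a. coeff_laurent f a \<noteq> 0 \<and> coeff_laurent g (e - a) \<noteq> 0}"
  by (intro finite_conv_support bounded_coeff_laurent)

lemma laurent_mult_commute: "f * g = g * (f :: 'a::comm_ring_1 laurent)"
proof (rule laurent_eqI)
  fix e
  show "coeff_laurent (f * g) e = coeff_laurent (g * f) e"
    unfolding times_laurent.rep_eq
    by (rule sum.reindex_bij_witness[of _ "\<lambda>a. e - a" "\<lambda>a. e - a"]) (auto simp: mult.commute)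
qed

lemma laurent_distrib_right: "(f + g) * h = f * h + g * (h :: 'a::comm_ring_1 laurent)"
proof (rule laurent_eqI)
  fix e
  let ?S = "{a. coeff_laurent f a \<noteq> 0 \<and> coeff_laurent h (e - a) \<noteq> 0} \<union>
            {a. coeff_laurent g a \<noteq> 0 \<and> coeff_laurent h (e - a) \<noteq> 0}"
  have fin: "finite ?S" by (simp add: finite_times_support)
  have "coeff_laurent ((f + g) * h) e = (\<Sum>a\<in>?S. coeff_laurent (f + g) a * coeff_laurent h (e - a))"
    using fin by (rule coeff_times_eq) (auto simp: plus_laurent.rep_eq)
  moreover have "coeff_laurent (f * h) e = (\<Sum>a\<in>?S. coeff_laurent f a * coeff_laurent h (e - a))"
    using fin by (rule coeff_times_eq) auto
  moreover have "coeff_laurent (g * h) e = (\<Sum>a\<in>?S. coeff_laurent g a * coeff_laurent h (e - a))"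
    using fin by (rule coeff_times_eq) auto
  ultimately show "coeff_laurent ((f + g) * h) e = coeff_laurent (f * h + g * h) e"
    by (simp add: plus_laurent.rep_eq algebra_simps sum.distrib)
qed

lemma coeff_monom_times:
  "coeff_laurent (monom_laurent c d * f) e = c * coeff_laurent (f :: 'a::comm_ring_1 laurent) (e - d)"
proof -
  have "coeff_laurent (monom_laurent c d * f) e =
      (\<Sum>a\<in>{d}. coeff_laurent (monom_laurent c d) a * coeff_laurent f (e - a))"
    by (rule coeff_times_eq) (auto simp: monom_laurent.rep_eq split: if_splits)
  then show ?thesis by (simp add: monom_laurent.rep_eq)
qed

lemma laurent_mult_assoc: "(f * g) * h = f * (g * (h :: 'a::comm_ring_1 laurent))"
proof (rule laurent_eqI)
  fix e
  let ?f = "coeff_laurent f" and ?g = "coeff_laurent g" and ?h = "coeff_laurent h"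
  obtain N0 where N0: "laurent_bounded N0 ?f" "laurent_bounded N0 ?g"
    using obtain_common_bound[OF bounded_coeff_laurent bounded_coeff_laurent] .
  obtain N1 where N1: "laurent_bounded N1 ?h" using bounded_coeff_laurent by blast
  define N where "N = max N0 N1"
  have N: "laurent_bounded N ?f" "laurent_bounded N ?g" "laurent_bounded N ?h"
    unfolding N_def by (rule laurent_bounded_mono, use N0 N1 in auto)+
  define B where "B = {a :: nat \<Rightarrow>\<^sub>0 int. Poly_Mapping.keys a \<subseteq> {..N} \<and>
     (\<forall>i\<in>{..N}. Poly_Mapping.lookup a i \<in> {- int N..Poly_Mapping.lookup e i + 2 * int N})}"
  define T where "T = {(a, b). a \<in> B \<and> b \<in> B \<and> ?f a \<noteq> 0 \<and> ?g b \<noteq> 0 \<and> ?h (e - a - b) \<noteq> 0}"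
  have finB: "finite B" unfolding B_def by (rule finite_exponent_box)
  have inB: "a \<in> B" "b \<in> B" if "?f a \<noteq> 0" "?g b \<noteq> 0" "?h (e - a - b) \<noteq> 0" for a b
  proof -
    have k: "Poly_Mapping.keys a \<subseteq> {..N}" "Poly_Mapping.keys b \<subseteq> {..N}"
      using N that by (auto simp: laurent_bounded_def)
    have l: "Poly_Mapping.lookup a i \<ge> - int N" "Poly_Mapping.lookup b i \<ge> - int N"
        "Poly_Mapping.lookup (e - a - b) i \<ge> - int N" for i
      using N that unfolding laurent_bounded_def by blast+
    have u: "Poly_Mapping.lookup a i \<le> Poly_Mapping.lookup e i + 2 * int N"
        "Poly_Mapping.lookup b i \<le> Poly_Mapping.lookup e i + 2 * int N" for i
      using l[of i] by (simp_all add: lookup_minus)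
    show "a \<in> B" "b \<in> B" using k l u by (auto simp: B_def)
  qed
  define R where "R = (\<Sum>(a, b)\<in>B \<times> B. ?f a * ?g b * ?h (e - a - b))"
  have "coeff_laurent ((f * g) * h) e = R"
  proof -
    define S where "S = (\<lambda>(a, b). a + b) ` (B \<times> B)"
    have finS: "finite S" unfolding S_def using finB by simp
    have sub: "a \<in> B" "s - a \<in> B" "s \<in> S" if "?f a \<noteq> 0" "?g (s - a) \<noteq> 0" "?h (e - s) \<noteq> 0" for s a
    proof -
      have "e - a - (s - a) = e - s" by (simp add: algebra_simps)
      then have h: "?h (e - a - (s - a)) \<noteq> 0" using that(3) by (simp only: not_False_eq_True)
      show a: "a \<in> B" by (rule inB(1)[OF that(1,2) h])
      show b: "s - a \<in> B" by (rule inB(2)[OF that(1,2) h])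
      have "s = (\<lambda>(a, b). a + b) (a, s - a)" by simp
      then show "s \<in> S" unfolding S_def using a b by (intro image_eqI[of _ _ "(a, s - a)"]) simp_all
    qed
    have "coeff_laurent ((f * g) * h) e = (\<Sum>s\<in>S. coeff_laurent (f * g) s * ?h (e - s))"
    proof (rule coeff_times_eq[OF finS], clarify)
      fix s assume s: "coeff_laurent (f * g) s \<noteq> 0" "?h (e - s) \<noteq> 0"
      then obtain a where "?f a \<noteq> 0" "?g (s - a) \<noteq> 0"
        unfolding times_laurent.rep_eq by (auto elim: sum.not_neutral_contains_not_neutral)
      then show "s \<in> S" using sub s(2) by blast
    qed
    also have "\<dots> = (\<Sum>s\<in>S. \<Sum>a\<in>B. ?f a * ?g (s - a) * ?h (e - s))"
    proof (rule sum.cong[OF refl])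
      fix s
      show "coeff_laurent (f * g) s * ?h (e - s) = (\<Sum>a\<in>B. ?f a * ?g (s - a) * ?h (e - s))"
      proof (cases "?h (e - s) = 0")
        case False
        have "coeff_laurent (f * g) s = (\<Sum>a\<in>B. ?f a * ?g (s - a))"
          by (rule coeff_times_eq[OF finB]) (use sub False in blast)
        then show ?thesis by (simp add: sum_distrib_right)
      qed simp
    qed
    also have "\<dots> = (\<Sum>(s, a)\<in>S \<times> B. ?f a * ?g (s - a) * ?h (e - s))"
      by (simp add: sum.cartesian_product)
    also have "\<dots> = (\<Sum>(s, a)\<in>{(s, a) \<in> S \<times> B. ?f a \<noteq> 0 \<and> ?g (s - a) \<noteq> 0 \<and> ?h (e - s) \<noteq> 0}.
        ?f a * ?g (s - a) * ?h (e - s))"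
      by (rule sum.mono_neutral_right) (use finS finB in auto)
    also have "\<dots> = (\<Sum>(a, b)\<in>T. ?f a * ?g b * ?h (e - a - b))"
    proof (rule sum.reindex_bij_witness[of _ "\<lambda>(a, b). (a + b, a)" "\<lambda>(s, a). (a, s - a)"], goal_cases)
      case (2 p)
      then obtain s a where p: "p = (s, a)" "a \<in> B" "?f a \<noteq> 0" "?g (s - a) \<noteq> 0" "?h (e - s) \<noteq> 0"
        by blast
      then have "s - a \<in> B" using sub by blast
      then show ?case using p by (simp add: T_def)
    next
      case (4 p)
      then show ?case by (auto simp: T_def S_def diff_diff_eq)
    qed auto
    also have "\<dots> = R" unfolding R_def
      by (rule sum.mono_neutral_left) (use finB in \<open>auto simp: T_def\<close>)
    finally show ?thesis .
  qed
  moreover have "coeff_laurent (f * (g * h)) e = R"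
  proof -
    have "coeff_laurent (f * (g * h)) e = (\<Sum>a\<in>B. ?f a * coeff_laurent (g * h) (e - a))"
    proof (rule coeff_times_eq[OF finB], clarify)
      fix a assume s: "?f a \<noteq> 0" "coeff_laurent (g * h) (e - a) \<noteq> 0"
      then obtain b where "?g b \<noteq> 0" "?h (e - a - b) \<noteq> 0"
        unfolding times_laurent.rep_eq by (auto elim: sum.not_neutral_contains_not_neutral)
      then show "a \<in> B" using inB s(1) by blast
    qed
    also have "\<dots> = (\<Sum>a\<in>B. \<Sum>b\<in>B. ?f a * ?g b * ?h (e - a - b))"
    proof (rule sum.cong[OF refl])
      fix a
      show "?f a * coeff_laurent (g * h) (e - a) = (\<Sum>b\<in>B. ?f a * ?g b * ?h (e - a - b))"
      proof (cases "?f a = 0")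
        case False
        have "coeff_laurent (g * h) (e - a) = (\<Sum>b\<in>B. ?g b * ?h (e - a - b))"
          by (rule coeff_times_eq[OF finB]) (use inB False in blast)
        then show ?thesis by (simp add: sum_distrib_left mult.assoc)
      qed simp
    qed
    also have "\<dots> = R" unfolding R_def by (simp add: sum.cartesian_product)
    finally show ?thesis .
  qed
  ultimately show "coeff_laurent ((f * g) * h) e = coeff_laurent (f * (g * h)) e" by simp
qed

instance laurent :: (comm_ring_1) comm_ring_1
proof
  fix f g h :: "'a laurent"
  show "f + g + h = f + (g + h)" "f + g = g + f" "0 + f = f" "- f + f = 0"
    by (rule laurent_eqI; simp add: plus_laurent.rep_eq zero_laurent.rep_eq uminus_laurent.rep_eq
        algebra_simps)+
  show "f - g = f + - g" by (rule minus_laurent_def)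
  show "f * g * h = f * (g * h)" by (rule laurent_mult_assoc)
  show "f * g = g * f" by (rule laurent_mult_commute)
  show "(f + g) * h = f * h + g * h" by (rule laurent_distrib_right)
  show "1 * f = f" by (rule laurent_eqI) (simp add: one_laurent_def coeff_monom_times)
  have "coeff_laurent (0 :: 'a laurent) 0 \<noteq> coeff_laurent 1 0"
    by (simp add: one_laurent_def zero_laurent.rep_eq monom_laurent.rep_eq)
  then show "(0 :: 'a laurent) \<noteq> 1" by metis
qed

lemma laurent_inverse_unique:
  fixes f :: "'a::comm_ring_1 laurent"
  assumes "f * g = 1" "f * h = 1"
  shows "g = h"
proof -
  have "g = (f * h) * g" by (simp add: assms(2))
  also have "\<dots> = (f * g) * h" by (metis mult.assoc mult.commute)
  finally show ?thesis by (simp add: assms(1))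
qed

text \<open>
  The ring is not a field, so division is total only by convention: non-units have inverse \<open>0\<close>.
  By \<open>laurent_inverse_var\<close>, \<open>laurent_geometric\<close>, \<open>coeff_inverse_one_minus_var\<close> and
  \<open>coeff_inverse_one_minus_var_mult\<close> below, the elements $x_i$, $1 - x_i$ and $1 - x_i x_j$ are
  units, and the inverses of the latter two are the expected power series expansions.
\<close>

instantiation laurent :: (comm_ring_1) inverse
begin
definition inverse_laurent :: "'a laurent \<Rightarrow> 'a laurent" where
  "inverse_laurent f = (if \<exists>g. f * g = 1 then THE g. f * g = 1 else 0)"
definition divide_laurent :: "'a laurent \<Rightarrow> 'a laurent \<Rightarrow> 'a laurent" where
  "divide_laurent f g = f * inverse g"
instance ..
end

lemma laurent_inverse_eqI:
  assumes "f * g = 1"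
  shows "inverse f = (g :: 'a::comm_ring_1 laurent)"
proof -
  have "(THE g. f * g = 1) = g"
    using assms by (rule the_equality) (rule laurent_inverse_unique[OF _ assms])
  moreover have "\<exists>g. f * g = 1" using assms by blast
  ultimately show ?thesis unfolding inverse_laurent_def by simp
qed

lemma monom_times_monom:
  "monom_laurent c d * monom_laurent c' d' = monom_laurent (c * c' :: 'a::comm_ring_1) (d + d')"
proof (rule laurent_eqI)
  fix e
  have "e - d = d' \<longleftrightarrow> e = d + d'" by (auto simp: algebra_simps)
  then show "coeff_laurent (monom_laurent c d * monom_laurent c' d') e =
      coeff_laurent (monom_laurent (c * c') (d + d')) e"
    by (simp add: coeff_monom_times monom_laurent.rep_eq)
qed

lemma laurent_inverse_var:
  "inverse (var i) = (monom_laurent 1 (Poly_Mapping.single i (-1)) :: 'a::comm_ring_1 laurent)"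
proof (rule laurent_inverse_eqI)
  have "Poly_Mapping.single i (1::int) + Poly_Mapping.single i (-1) = 0"
    by (metis add.right_inverse single_add single_zero)
  then show "var i * monom_laurent 1 (Poly_Mapping.single i (-1)) = (1 :: 'a laurent)"
    by (simp only: var_def monom_times_monom one_laurent_def mult_1)
qed

lemma laurent_geometric:
  fixes d :: "nat \<Rightarrow>\<^sub>0 int"
  assumes d0: "d \<noteq> 0" and pos: "\<And>i. Poly_Mapping.lookup d i \<ge> 0"
  shows "(1 - monom_laurent 1 d) * inverse (1 - monom_laurent 1 d) = (1 :: 'a::comm_ring_1 laurent)"
    and "coeff_laurent (inverse (1 - monom_laurent 1 d) :: 'a::comm_ring_1 laurent) e =
      (if \<exists>k::nat. \<forall>i. Poly_Mapping.lookup e i = int k * Poly_Mapping.lookup d i then 1 else 0)"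
proof -
  let ?P = "\<lambda>e. \<exists>k::nat. \<forall>i. Poly_Mapping.lookup e i = int k * Poly_Mapping.lookup d i"
  define N where "N = Max (insert 0 (Poly_Mapping.keys d))"
  have N: "Poly_Mapping.keys d \<subseteq> {..N}"
    unfolding N_def by (intro subsetI atMost_iff[THEN iffD2] Max_ge) simp_all
  have "laurent_bounded N (\<lambda>e. if ?P e then 1 else 0 :: 'a)"
    unfolding laurent_bounded_def
  proof (intro allI impI)
    fix e assume "(if ?P e then 1 else 0 :: 'a) \<noteq> 0"
    then obtain k :: nat where k: "\<And>i. Poly_Mapping.lookup e i = int k * Poly_Mapping.lookup d i"
      by presburger
    have "Poly_Mapping.keys e \<subseteq> Poly_Mapping.keys d" by (auto simp: in_keys_iff k)
    moreover have "0 \<le> Poly_Mapping.lookup e i" for i by (simp add: k pos)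
    ultimately show "Poly_Mapping.keys e \<subseteq> {..N} \<and> (\<forall>i. - int N \<le> Poly_Mapping.lookup e i)"
      using N by (meson neg_0_le_iff_le neg_le_0_iff_le of_nat_0_le_iff order_trans subset_trans)
  qed
  then have C: "coeff_laurent (Abs_laurent (\<lambda>e. if ?P e then 1 else 0 :: 'a)) =
      (\<lambda>e. if ?P e then 1 else 0)"
    by (intro Abs_laurent_inverse) blast
  define G where "G = Abs_laurent (\<lambda>e. if ?P e then 1 else 0 :: 'a)"
  have cG: "coeff_laurent G e = (if ?P e then 1 else 0)" for e by (simp add: G_def C)
  obtain i0 where i0: "Poly_Mapping.lookup d i0 \<noteq> 0"
    using d0 by (metis lookup_zero poly_mapping_eqI)
  have step: "?P e \<longleftrightarrow> ?P (e - d) \<or> e = 0" for e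
  proof
    assume "?P e"
    then obtain k :: nat where k: "\<And>i. Poly_Mapping.lookup e i = int k * Poly_Mapping.lookup d i"
      by blast
    show "?P (e - d) \<or> e = 0"
    proof (cases k)
      case 0
      then show ?thesis using k by (auto intro: poly_mapping_eqI)
    next
      case (Suc j)
      then have "\<forall>i. Poly_Mapping.lookup (e - d) i = int j * Poly_Mapping.lookup d i"
        by (simp add: lookup_minus k algebra_simps)
      then show ?thesis by blast
    qed
  next
    assume "?P (e - d) \<or> e = 0"
    then show "?P e"
    proof
      assume "?P (e - d)"
      then obtain k :: nat
        where k: "\<And>i. Poly_Mapping.lookup (e - d) i = int k * Poly_Mapping.lookup d i"
        by blast
      have "Poly_Mapping.lookup e i = int (Suc k) * Poly_Mapping.lookup d i" for i
        using k[of i] by (simp add: lookup_minus algebra_simps)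
      then show "?P e" by blast
    next
      assume "e = 0"
      then show "?P e" by (intro exI[of _ 0]) simp
    qed
  qed
  have no: "\<not> ?P (0 - d)"
  proof
    assume "?P (0 - d)"
    then obtain k :: nat where "Poly_Mapping.lookup (0 - d) i0 = int k * Poly_Mapping.lookup d i0"
      by blast
    then have "(int k + 1) * Poly_Mapping.lookup d i0 = 0" by (simp add: lookup_minus algebra_simps)
    then show False using i0 by auto
  qed
  have "(1 - monom_laurent 1 d) * G = 1"
  proof (rule laurent_eqI)
    fix e
    have "(1 - monom_laurent 1 d) * G = G + - (monom_laurent 1 d * G)"
      by (simp add: left_diff_distrib)
    then have "coeff_laurent ((1 - monom_laurent 1 d) * G) e =
        coeff_laurent (G + - (monom_laurent 1 d * G)) e"
      by (rule arg_cong)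
    also have "\<dots> = coeff_laurent G e - coeff_laurent G (e - d)"
      unfolding plus_laurent.rep_eq uminus_laurent.rep_eq coeff_monom_times by simp
    also have "\<dots> = (if e = 0 then 1 else 0)"
    proof (cases "e = 0")
      case True
      have "?P 0" using step[of 0] by blast
      then show ?thesis unfolding cG using no True by simp
    next
      case False
      then show ?thesis unfolding cG using step[of e] by simp
    qed
    finally show "coeff_laurent ((1 - monom_laurent 1 d) * G) e = coeff_laurent 1 e"
      by (simp add: one_laurent_def monom_laurent.rep_eq)
  qed
  then have inv: "inverse (1 - monom_laurent 1 d) = G" and "(1 - monom_laurent 1 d) * G = 1"
    by (simp_all add: laurent_inverse_eqI)
  then show "(1 - monom_laurent 1 d) * inverse (1 - monom_laurent 1 d) = (1 :: 'a laurent)" by simp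
  show "coeff_laurent (inverse (1 - monom_laurent 1 d) :: 'a laurent) e =
      (if \<exists>k::nat. \<forall>i. Poly_Mapping.lookup e i = int k * Poly_Mapping.lookup d i then 1 else 0)"
    unfolding inv by (rule cG)
qed

lemma single_multiple_iff:
  "(\<exists>k::nat. \<forall>l. Poly_Mapping.lookup e l = int k * Poly_Mapping.lookup (Poly_Mapping.single i 1) l) \<longleftrightarrow>
   (\<exists>k::nat. e = Poly_Mapping.single i (int k))"
proof -
  have "(\<forall>l. Poly_Mapping.lookup e l = int k * Poly_Mapping.lookup (Poly_Mapping.single i 1) l) \<longleftrightarrow>
      e = Poly_Mapping.single i (int k)" for k
    unfolding poly_mapping_eq_iff fun_eq_iff lookup_single when_def by auto
  then show ?thesis by simp
qed

lemma coeff_inverse_one_minus_var: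
  "coeff_laurent (inverse (1 - var i) :: 'a::comm_ring_1 laurent) e =
     (if \<exists>k::nat. e = Poly_Mapping.single i (int k) then 1 else 0)"
proof -
  have "Poly_Mapping.single i (1::int) \<noteq> 0" by (simp add: poly_mapping_eq_iff fun_eq_iff lookup_single when_def)
  then show ?thesis
    unfolding var_def by (subst laurent_geometric(2)) (simp_all only: single_multiple_iff, simp_all add: lookup_single when_def)
qed

lemma coeff_inverse_one_minus_var_mult:
  "coeff_laurent (inverse (1 - var i * var j) :: 'a::comm_ring_1 laurent) e =
     (if \<exists>k::nat. e = Poly_Mapping.single i (int k) + Poly_Mapping.single j (int k) then 1 else 0)"
proof -
  let ?d = "Poly_Mapping.single i 1 + Poly_Mapping.single j (1::int)"
  have "Poly_Mapping.lookup ?d i \<noteq> 0" by (simp add: lookup_add lookup_single when_def)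
  then have "?d \<noteq> 0" by force
  moreover have "(\<forall>l. Poly_Mapping.lookup e l = int k * Poly_Mapping.lookup ?d l) \<longleftrightarrow>
      e = Poly_Mapping.single i (int k) + Poly_Mapping.single j (int k)" for k
    unfolding poly_mapping_eq_iff fun_eq_iff lookup_add lookup_single when_def by (auto simp: algebra_simps)
  ultimately show ?thesis
    unfolding var_def monom_times_monom
    by (simp add: laurent_geometric(2) lookup_add lookup_single when_def)
qed


section \<open>Symmetric polynomials, substitution, and the determinants\<close>

text \<open>
  \<open>P :: (nat \<Rightarrow>\<^sub>0 nat) \<Rightarrow>\<^sub>0 'a\<close> is a polynomial in variables indexed by natural numbers;
  the variables of an \<open>n\<close>-variable polynomial carry the indices \<open>1, \<dots>, n\<close>.
\<close>

definition symmetric_poly :: "nat \<Rightarrow> ((nat \<Rightarrow>\<^sub>0 nat) \<Rightarrow>\<^sub>0 'a::zero) \<Rightarrow> bool" where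
  "symmetric_poly n P \<longleftrightarrow>
     (\<forall>m\<in>Poly_Mapping.keys P. Poly_Mapping.keys m \<subseteq> {1..n}) \<and>
     (\<forall>\<pi>. \<pi> permutes {1..n} \<longrightarrow>
        (\<forall>m. Poly_Mapping.lookup P (Poly_Mapping.map_key \<pi> m) = Poly_Mapping.lookup P m))"

definition subst_poly ::
  "((nat \<Rightarrow>\<^sub>0 nat) \<Rightarrow>\<^sub>0 'a::comm_ring_1) \<Rightarrow> (nat \<Rightarrow> 'a laurent) \<Rightarrow> 'a laurent" where
  "subst_poly P y = (\<Sum>m\<in>Poly_Mapping.keys P. const_laurent (Poly_Mapping.lookup P m) *
     (\<Prod>i\<in>Poly_Mapping.keys m. y i ^ Poly_Mapping.lookup m i))"

text \<open>Matrix indices start at 0, whence the shifts by one.\<close>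

definition B_det :: "nat \<Rightarrow> rat laurent" where
  "B_det k = det (mat k k (\<lambda>(i, j). var (i + 1) powi (- int (j + 1)) - var (i + 1) powi int (j + 1)))"

definition Bbar_det :: "nat \<Rightarrow> rat laurent" where
  "Bbar_det k = det (mat k k (\<lambda>(i, j). var (i + 1) powi (int (j + 1) - 1) + var (i + 1) powi (- int (j + 1))))"

text \<open>The point $(x_1, \dots, x_k, x_1^{-1}, \dots, x_k^{-1}, 1)$, with entries indexed from 1.\<close>

definition paired_point :: "nat \<Rightarrow> nat \<Rightarrow> rat laurent" where
  "paired_point k i = (if i \<le> k then var i else if i \<le> 2 * k then inverse (var (i - k)) else 1)"

definition Q_series :: "nat \<Rightarrow> ((nat \<Rightarrow>\<^sub>0 nat) \<Rightarrow>\<^sub>0 rat) \<Rightarrow> rat laurent" where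
  "Q_series n P =
     ((\<Prod>(i, j) \<in> {(i, j). i \<in> {1..n} \<and> j \<in> {1..n} \<and> i \<noteq> j}. 1 - var i / var j) *
        subst_poly P (\<lambda>i. inverse (var i))) /
     ((\<Prod>i = 1..n. 1 - var i) *
        (\<Prod>(i, j) \<in> {(i, j). 1 \<le> i \<and> i < j \<and> j \<le> n}. 1 - var i * var j))"

fun double_fact :: "nat \<Rightarrow> nat" where
  "double_fact 0 = 1"
| "double_fact (Suc 0) = 1"
| "double_fact (Suc (Suc n)) = Suc (Suc n) * double_fact n"

end

theory Submission
  imports Defs "HOL-Computational_Algebra.Polynomial_Factorial"
begin

text \<open>
  By Schur's Pfaffian for $\prod_{i<j} \frac{x_i - x_j}{1 - x_i x_j}$ and the symmetry of $Q$ under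
  permutations of the variables, the variables can be split off $Q$ two at a time (and first a single
  one if $n$ is odd): each step keeps one term of the Pfaffian expansion and multiplies the constant
  term by the number of equal terms, which gives the double factorials.  What remains is a polynomial
  in the $x_i^{-1}$ times a product of kernels in disjoint pairs of variables.  Against such a kernel,
  taking the constant term of a monomial $x^{-a} y^{-b}$ amounts to substituting
  $x^{-1} = z$, $y^{-1} = z^{-1}$ and taking the constant term against $(1 + z)(1 + z^{-1})$.  The
  determinants are Vandermonde determinants in $z_i + z_i^{-1}$, up to simple factors, and the two forms
  of the right-hand side differ by the Leibniz expansion of one determinant, all of whose terms
  contribute equally.
\<close>

section \<open>Laurent series\<close>

text \<open>The differences x_i - x_l are not units of the ring, yet the Pfaffian expansion has them
  as denominators. It is therefore proved in the fraction field, for which the ring must first be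
  shown to be an integral domain; the identity (1/x - 1/y)(x - y) = (1 - x/y)(1 - y/x) brings each
  term back into the ring. No Pfaffian is formed: expanding along one row, again and again,
  suffices. The specialization is not a ring homomorphism on series. It is an equality of two linear
  functionals on polynomials in 1/x and 1/y: both give the monomial with exponents a, b the value 2,
  1 or 0 according to whether |a - b| is 0, 1 or larger. So everything except the kernels has to be
  kept as one polynomial in the inverse variables, including the cross factors left by the
  splitting. In the odd case the unpaired variable carries 1/(1 - x), against which every power of
  1/x has constant term 1; this evaluates it at 1. The constants of the two forms agree because
  (2k)! = 2^k k! (2k-1)!!, where k! counts the Leibniz terms.\<close>

lemma coeff_laurent_simps [simp]:
  fixes f g :: "'a::comm_ring_1 laurent"
  shows "coeff_laurent (f + g) e = coeff_laurent f e + coeff_laurent g e"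
    and "coeff_laurent (f - g) e = coeff_laurent f e - coeff_laurent g e"
    and "coeff_laurent (- f) e = - coeff_laurent f e"
    and "coeff_laurent (0 :: 'a laurent) e = 0"
    and "coeff_laurent (1 :: 'a laurent) e = (if e = 0 then 1 else 0)"
    and "coeff_laurent (monom_laurent c d) e = (if e = d then c else 0)"
  unfolding minus_laurent_def plus_laurent.rep_eq uminus_laurent.rep_eq zero_laurent.rep_eq
    one_laurent_def monom_laurent.rep_eq
  by simp_all

text \<open>Integer exponents are not well ordered, but the uniform lower bound gives a minimum in
  each coordinate, and only the N + 1 coordinates up to N can be nonzero. Minimizing them in turn
  yields a leading exponent, from which the absence of zero divisors follows.\<close>

lemma ex_lex_least_exponent:
  assumes "S \<noteq> {}" and bnd: "\<And>e. e \<in> S \<Longrightarrow> Poly_Mapping.keys e \<subseteq> {..N} \<and> (\<forall>i. - int N \<le> Poly_Mapping.lookup e i)"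
  shows "\<exists>a\<in>S. \<forall>e\<in>S. a \<le> (e :: nat \<Rightarrow>\<^sub>0 int)"
proof -
  have *: "\<exists>a\<in>S. \<forall>e\<in>S. \<forall>j<m. (\<forall>i<j. Poly_Mapping.lookup e i = Poly_Mapping.lookup a i) \<longrightarrow>
      Poly_Mapping.lookup a j \<le> Poly_Mapping.lookup e j" for m
  proof (induction m)
    case 0
    then show ?case using \<open>S \<noteq> {}\<close> by auto
  next
    case (Suc m)
    then obtain a where a: "a \<in> S" and least: "\<And>e j. e \<in> S \<Longrightarrow> j < m \<Longrightarrow>
        (\<And>i. i < j \<Longrightarrow> Poly_Mapping.lookup e i = Poly_Mapping.lookup a i) \<Longrightarrow>
        Poly_Mapping.lookup a j \<le> Poly_Mapping.lookup e j"
      by blast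
    \<comment> \<open>\<open>T\<close> keeps the exponents tied with \<open>a\<close> in the
      coordinates treated so far. Adding N turns coordinate m into a natural number, which can be
      minimized over \<open>T\<close>.\<close>
    define T where "T = {e \<in> S. \<forall>i<m. Poly_Mapping.lookup e i = Poly_Mapping.lookup a i}"
    define h where "h e = nat (Poly_Mapping.lookup e m + int N)" for e :: "nat \<Rightarrow>\<^sub>0 int"
    have "a \<in> T" using a by (simp add: T_def)
    then obtain b where b: "b \<in> T" and hb: "\<And>e. e \<in> T \<Longrightarrow> h b \<le> h e"
      using ex_has_least_nat[of "\<lambda>e. e \<in> T" a h] by blast
    have "b \<in> S" using b by (simp add: T_def)
    moreover have "Poly_Mapping.lookup b j \<le> Poly_Mapping.lookup e j"
      if e: "e \<in> S" and j: "j < Suc m"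
        and eq: "\<forall>i<j. Poly_Mapping.lookup e i = Poly_Mapping.lookup b i" for e j
    proof (cases "j < m")
      case True
      then have "Poly_Mapping.lookup a j \<le> Poly_Mapping.lookup e j"
        using e eq b by (intro least) (auto simp: T_def)
      then show ?thesis using True b by (simp add: T_def)
    next
      case False
      then have "j = m" using j by simp
      have "e \<in> T" using e eq b \<open>j = m\<close> by (auto simp: T_def)
      have "- int N \<le> Poly_Mapping.lookup b m" "- int N \<le> Poly_Mapping.lookup e m"
        using bnd[OF \<open>b \<in> S\<close>] bnd[OF e] by blast+
      with hb[OF \<open>e \<in> T\<close>] show ?thesis unfolding h_def \<open>j = m\<close> by linarith
    qed
    ultimately show ?case by blast
  qed
  from *[of "Suc N"] obtain a where a: "a \<in> S" and least: "\<And>e j. e \<in> S \<Longrightarrow> j < Suc N \<Longrightarrow>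
      (\<And>i. i < j \<Longrightarrow> Poly_Mapping.lookup e i = Poly_Mapping.lookup a i) \<Longrightarrow>
      Poly_Mapping.lookup a j \<le> Poly_Mapping.lookup e j"
    by blast
  have "a \<le> e" if e: "e \<in> S" for e
  proof (rule ccontr)
    assume "\<not> a \<le> e"
    then have "e < a" by simp
    then obtain j where j: "Poly_Mapping.lookup e j < Poly_Mapping.lookup a j"
      and eq: "\<And>i. i < j \<Longrightarrow> Poly_Mapping.lookup e i = Poly_Mapping.lookup a i"
      by (auto simp: less_poly_mapping.rep_eq less_fun_def)
    have "j \<le> N"
    proof (rule ccontr)
      assume "\<not> j \<le> N"
      then have "j \<notin> Poly_Mapping.keys e" "j \<notin> Poly_Mapping.keys a" using bnd e a by fastforce+
      then show False using j by (simp add: in_keys_iff)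
    qed
    then show False using least[OF e _ eq, of j] j by simp
  qed
  then show ?thesis using a by blast
qed

lemma ex_least_exponent:
  fixes f :: "'a::comm_ring_1 laurent"
  assumes "f \<noteq> 0"
  obtains a where "coeff_laurent f a \<noteq> 0" "\<And>e. coeff_laurent f e \<noteq> 0 \<Longrightarrow> a \<le> e"
proof -
  obtain N where N: "laurent_bounded N (coeff_laurent f)" using bounded_coeff_laurent by blast
  have "{e. coeff_laurent f e \<noteq> 0} \<noteq> {}" using assms laurent_eqI[of f 0] by auto
  then have "\<exists>a\<in>{e. coeff_laurent f e \<noteq> 0}. \<forall>e\<in>{e. coeff_laurent f e \<noteq> 0}. a \<le> e"
    by (rule ex_lex_least_exponent[of _ N]) (use N in \<open>simp add: laurent_bounded_def\<close>)
  then show ?thesis using that by blast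
qed

instance laurent :: (idom) idom
proof
  fix f g :: "'a laurent"
  assume "f \<noteq> 0" "g \<noteq> 0"
  obtain a where a: "coeff_laurent f a \<noteq> 0" "\<And>e. coeff_laurent f e \<noteq> 0 \<Longrightarrow> a \<le> e"
    using ex_least_exponent[OF \<open>f \<noteq> 0\<close>] by blast
  obtain b where b: "coeff_laurent g b \<noteq> 0" "\<And>e. coeff_laurent g e \<noteq> 0 \<Longrightarrow> b \<le> e"
    using ex_least_exponent[OF \<open>g \<noteq> 0\<close>] by blast
  \<comment> \<open>Minimality of a gives a \<le> c and minimality of b gives c \<le> a, so the two
    leading terms alone contribute at a + b.\<close>
  have "coeff_laurent (f * g) (a + b) = (\<Sum>c\<in>{a}. coeff_laurent f c * coeff_laurent g (a + b - c))"
  proof (rule coeff_times_eq, simp, clarify)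
    fix c assume "coeff_laurent f c \<noteq> 0" "coeff_laurent g (a + b - c) \<noteq> 0"
    then have "a \<le> c" "b \<le> a + b - c" using a b by blast+
    then show "c = a" by (simp add: le_diff_eq)
  qed
  then have "coeff_laurent (f * g) (a + b) \<noteq> 0" using a b by simp
  then show "f * g \<noteq> 0" by auto
qed

section \<open>Constant terms and units\<close>

lemma CT_simps [simp]:
  fixes f g :: "'a::comm_ring_1 laurent"
  shows "CT (f + g) = CT f + CT g" "CT (f - g) = CT f - CT g" "CT (- f) = - CT f"
    "CT (0 :: 'a laurent) = 0" "CT (1 :: 'a laurent) = 1" "CT (const_laurent c * f) = c * CT f"
  by (simp_all add: CT_def const_laurent_def coeff_monom_times)

lemma CT_sum: "CT (\<Sum>i\<in>I. f i) = (\<Sum>i\<in>I. CT (f i :: 'a::comm_ring_1 laurent))"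
  by (induction I rule: infinite_finite_induct) auto

lemma CT_power_neg_one_mult: "CT ((- 1) ^ m * f) = (- 1) ^ m * CT (f :: 'a::comm_ring_1 laurent)"
  by (induction m) auto

lemma const_laurent_simps:
  fixes c d :: "'a::comm_ring_1"
  shows "const_laurent (c + d) = const_laurent c + const_laurent d"
    "const_laurent (c * d) = const_laurent c * const_laurent d"
    "const_laurent (0 :: 'a) = 0" "const_laurent (1 :: 'a) = 1"
  by (auto intro!: laurent_eqI simp: const_laurent_def monom_times_monom)

abbreviation var_inv :: "nat \<Rightarrow> 'a::comm_ring_1 laurent" where
  "var_inv i \<equiv> inverse (var i)"

lemma var_mult_var_inv [simp]:
  "var i * var_inv i = (1 :: 'a::comm_ring_1 laurent)" "var_inv i * var i = (1 :: 'a laurent)"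
proof -
  have "Poly_Mapping.single i (1::int) + Poly_Mapping.single i (-1) = 0"
    by (simp flip: single_add)
  then show *: "var i * var_inv i = (1 :: 'a laurent)"
    by (simp only: laurent_inverse_var) (simp add: var_def monom_times_monom one_laurent_def)
  then show "var_inv i * var i = (1 :: 'a laurent)" by (simp only: mult.commute)
qed

lemma one_minus_var_mult_inverse [simp]:
  "(1 - var i) * inverse (1 - var i) = (1 :: 'a::comm_ring_1 laurent)"
proof -
  have "Poly_Mapping.single i (1::int) \<noteq> 0" by (metis lookup_single_eq lookup_zero zero_neq_one)
  then show ?thesis unfolding var_def by (intro laurent_geometric) (auto simp: lookup_single when_def)
qed

lemma one_minus_var_var_mult_inverse [simp]:
  "(1 - var i * var j) * inverse (1 - var i * var j) = (1 :: 'a::comm_ring_1 laurent)"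
proof -
  let ?d = "Poly_Mapping.single i 1 + Poly_Mapping.single j (1::int)"
  have "Poly_Mapping.lookup ?d i \<noteq> 0" by (simp add: lookup_add lookup_single when_def)
  then have "?d \<noteq> 0" by force
  then show ?thesis unfolding var_def monom_times_monom mult_1
    by (intro laurent_geometric) (auto simp: lookup_single lookup_add when_def)
qed

lemma laurent_inverse_mult:
  fixes f g :: "'a::comm_ring_1 laurent"
  assumes "f * inverse f = 1" "g * inverse g = 1"
  shows "inverse (f * g) = inverse f * inverse g"
  by (rule laurent_inverse_eqI) (metis assms mult.assoc mult.left_commute mult.right_neutral)

lemma laurent_inverse_prod:
  fixes f :: "'b \<Rightarrow> 'a::comm_ring_1 laurent"
  assumes "\<And>i. i \<in> I \<Longrightarrow> f i * inverse (f i) = 1"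
  shows "inverse (\<Prod>i\<in>I. f i) = (\<Prod>i\<in>I. inverse (f i)) \<and> (\<Prod>i\<in>I. f i) * inverse (\<Prod>i\<in>I. f i) = 1"
proof (rule conjI)
  have *: "(\<Prod>i\<in>I. f i) * (\<Prod>i\<in>I. inverse (f i)) = 1"
    by (simp add: assms flip: prod.distrib)
  then show "inverse (\<Prod>i\<in>I. f i) = (\<Prod>i\<in>I. inverse (f i))" by (rule laurent_inverse_eqI)
  with * show "(\<Prod>i\<in>I. f i) * inverse (\<Prod>i\<in>I. f i) = 1" by simp
qed

text \<open>This sends \<open>x\<^sub>i\<close> to \<open>x\<^bsub>\<pi> i\<^esub>\<close> if \<open>\<pi>\<close> is bijective, and is meaningless otherwise.\<close>

definition rename_vars :: "(nat \<Rightarrow> nat) \<Rightarrow> 'a::zero laurent \<Rightarrow> 'a laurent" where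
  "rename_vars \<pi> f = Abs_laurent (\<lambda>e. coeff_laurent f (Poly_Mapping.map_key \<pi> e))"

lemma coeff_rename_vars:
  assumes "bij \<pi>"
  shows "coeff_laurent (rename_vars \<pi> f) e = coeff_laurent (f :: 'a::zero laurent) (Poly_Mapping.map_key \<pi> e)"
proof -
  have inj: "inj \<pi>" using assms by (rule bij_is_inj)
  obtain N where N: "laurent_bounded N (coeff_laurent f)" using coeff_laurent[of f] by auto
  \<comment> \<open>\<pi> may move the indices up to N further out, hence the maximum over their
    images.\<close>
  define M where "M = max N (Max (\<pi> ` {..N}))"
  have "laurent_bounded M (\<lambda>e. coeff_laurent f (Poly_Mapping.map_key \<pi> e))"
    unfolding laurent_bounded_def
  proof (intro allI impI)
    fix e assume "coeff_laurent f (Poly_Mapping.map_key \<pi> e) \<noteq> 0"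
    then have k: "Poly_Mapping.keys (Poly_Mapping.map_key \<pi> e) \<subseteq> {..N}"
      and l: "\<And>i. - int N \<le> Poly_Mapping.lookup (Poly_Mapping.map_key \<pi> e) i"
      using N by (auto simp: laurent_bounded_def)
    have "i \<le> M" if "i \<in> Poly_Mapping.keys e" for i
    proof -
      obtain j where j: "i = \<pi> j" using assms by (metis bij_pointE)
      then have "j \<in> {..N}" using k that inj by (auto simp: keys_map_key)
      then show ?thesis unfolding M_def j by (intro max.coboundedI2 Max_ge) auto
    qed
    moreover have "- int M \<le> Poly_Mapping.lookup e i" for i
    proof -
      obtain j where "i = \<pi> j" using assms by (metis bij_pointE)
      then show ?thesis using l[of j] inj by (simp add: map_key.rep_eq M_def)
    qed
    ultimately show "Poly_Mapping.keys e \<subseteq> {..M} \<and> (\<forall>i. - int M \<le> Poly_Mapping.lookup e i)" by auto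
  qed
  then show ?thesis unfolding rename_vars_def by (subst Abs_laurent_inverse) auto
qed

section \<open>Renaming of variables as a ring homomorphism that preserves constant terms\<close>

context
  fixes \<pi> :: "nat \<Rightarrow> nat"
  assumes bij: "bij \<pi>"
begin

lemma map_key_eq_iff: "Poly_Mapping.map_key \<pi> d = e \<longleftrightarrow> d = Poly_Mapping.map_key (Hilbert_Choice.inv \<pi>) (e :: nat \<Rightarrow>\<^sub>0 'b::zero)"
proof -
  have i: "inj \<pi>" "inj (Hilbert_Choice.inv \<pi>)" "Hilbert_Choice.inv \<pi> \<circ> \<pi> = id" "\<pi> \<circ> Hilbert_Choice.inv \<pi> = id"
    using bij bij_is_inj bij_imp_bij_inv bij_is_surj surj_iff inj_iff by metis+
  then have "Poly_Mapping.map_key \<pi> (Poly_Mapping.map_key (Hilbert_Choice.inv \<pi>) e) = e"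
    "Poly_Mapping.map_key (Hilbert_Choice.inv \<pi>) (Poly_Mapping.map_key \<pi> d) = d"
    by (simp_all add: map_key_compose map_key_id id_def)
  then show ?thesis by metis
qed

lemma CT_rename_vars [simp]: "CT (rename_vars \<pi> f) = CT f"
  using bij by (simp add: CT_def coeff_rename_vars bij_is_inj)

lemma rename_vars_add: "rename_vars \<pi> (f + g) = rename_vars \<pi> f + rename_vars \<pi> (g :: 'a::comm_ring_1 laurent)"
  by (rule laurent_eqI) (simp add: coeff_rename_vars[OF bij])

lemma rename_vars_mult: "rename_vars \<pi> (f * g) = rename_vars \<pi> f * rename_vars \<pi> (g :: 'a::comm_ring_1 laurent)"
proof (rule laurent_eqI)
  fix e
  let ?k = "Poly_Mapping.map_key \<pi> :: _ \<Rightarrow> nat \<Rightarrow>\<^sub>0 int" and ?k' = "Poly_Mapping.map_key (Hilbert_Choice.inv \<pi>)"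
  have plus: "?k (a + b) = ?k a + ?k b" for a b using bij by (simp add: map_key_plus bij_is_inj)
  have minus: "?k (a - b) = ?k a - ?k b" for a b
    using plus[of "a - b" b] by (simp add: eq_diff_eq)
  have k'k: "?k' (?k a) = a" "?k (?k' a) = a" for a using map_key_eq_iff by metis+
  show "coeff_laurent (rename_vars \<pi> (f * g)) e = coeff_laurent (rename_vars \<pi> f * rename_vars \<pi> g) e"
    unfolding times_laurent.rep_eq coeff_rename_vars[OF bij]
    by (rule sum.reindex_bij_witness[of _ ?k ?k']) (auto simp: minus k'k)
qed

lemma rename_vars_monom: "rename_vars \<pi> (monom_laurent c d) = monom_laurent (c :: 'a::comm_ring_1) (Poly_Mapping.map_key (Hilbert_Choice.inv \<pi>) d)"
  by (rule laurent_eqI) (simp add: coeff_rename_vars[OF bij] map_key_eq_iff)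

lemma rename_vars_0 [simp]: "rename_vars \<pi> 0 = (0 :: 'a::comm_ring_1 laurent)"
  by (rule laurent_eqI) (simp add: coeff_rename_vars[OF bij])

lemma rename_vars_const [simp]: "rename_vars \<pi> (const_laurent c) = const_laurent (c :: 'a::comm_ring_1)"
  using bij by (simp add: const_laurent_def rename_vars_monom bij_imp_bij_inv bij_is_inj)

lemma rename_vars_1 [simp]: "rename_vars \<pi> 1 = (1 :: 'a::comm_ring_1 laurent)"
  using rename_vars_const[of 1] by (simp add: const_laurent_simps)

lemma comm_ring_hom_rename_vars: "comm_ring_hom (rename_vars \<pi> :: 'a::comm_ring_1 laurent \<Rightarrow> 'a laurent)"
  by standard (simp_all add: rename_vars_add rename_vars_mult)

interpretation rename: comm_ring_hom "rename_vars \<pi> :: 'a::comm_ring_1 laurent \<Rightarrow> 'a laurent"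
  by (rule comm_ring_hom_rename_vars)

lemmas rename_vars_diff = rename.hom_minus
lemmas rename_vars_power = rename.hom_power
lemmas rename_vars_sum = rename.hom_sum
lemmas rename_vars_prod = rename.hom_prod

lemma rename_vars_var [simp]: "rename_vars \<pi> (var i) = (var (\<pi> i) :: 'a::comm_ring_1 laurent)"
proof -
  have "Poly_Mapping.map_key (Hilbert_Choice.inv \<pi>) (Poly_Mapping.single i (1::int)) = Poly_Mapping.single (\<pi> i) 1"
    using map_key_single[of "Hilbert_Choice.inv \<pi>" "\<pi> i" "1::int"] bij
    by (simp add: bij_imp_bij_inv bij_is_inj)
  then show ?thesis by (simp add: var_def rename_vars_monom)
qed

lemma rename_vars_inverse:
  fixes f :: "'a::comm_ring_1 laurent"
  assumes "f * inverse f = 1"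
  shows "rename_vars \<pi> (inverse f) = inverse (rename_vars \<pi> f)"
  by (rule laurent_inverse_eqI[symmetric]) (simp add: assms flip: rename_vars_mult)

end

section \<open>Pfaffian expansions\<close>

text \<open>As functions of t, the two sides differ by N/M, with N and M of degree at most |L|. Both
  polynomials vanish at every 1/x_i, and N = K M holds at t = 1, so N = K M identically. As |L| is
  odd, N(-1) = -K M(-1), which forces K = 0 when 2 is nonzero. The values t = 1 and t = x_a are the
  ones used later.\<close>

lemma partial_fractions_odd:
  fixes x :: "'i \<Rightarrow> 'a::field"
  assumes fin: "finite L" and odd: "odd (card L)" and inj: "inj_on x L" and two: "(2::'a) \<noteq> 0"
    and x: "\<And>l. l \<in> L \<Longrightarrow> x l \<noteq> 0" "\<And>l. l \<in> L \<Longrightarrow> x l \<noteq> 1" "\<And>l. l \<in> L \<Longrightarrow> x l \<noteq> - 1"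
    and t: "\<And>l. l \<in> L \<Longrightarrow> t * x l \<noteq> 1"
  shows "(\<Prod>l\<in>L. (t - x l) / (1 - t * x l)) =
    (\<Sum>j\<in>L. (t - x j) / (1 - t * x j) * (\<Prod>l\<in>L - {j}. (1 - x j * x l) / (x j - x l)))"
proof -
  define c where "c j = (\<Prod>l\<in>L - {j}. (1 - x j * x l) / (x j - x l))" for j
  define K where "K = 1 - sum c L"
  define N where "N = (\<Prod>l\<in>L. [:- x l, 1:]) -
      (\<Sum>j\<in>L. smult (c j) ([:- x j, 1:] * (\<Prod>l\<in>L - {j}. [:1, - x l:])))"
  define M where "M = (\<Prod>l\<in>L. [:1, - x l:])"
  have N: "poly N s = (\<Prod>l\<in>L. s - x l) - (\<Sum>j\<in>L. c j * ((s - x j) * (\<Prod>l\<in>L - {j}. 1 - s * x l)))" for s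
    by (simp add: N_def poly_prod poly_sum algebra_simps)
  have M: "poly M s = (\<Prod>l\<in>L. 1 - s * x l)" for s
    by (simp add: M_def poly_prod)
  have degM: "Polynomial.degree (\<Prod>l\<in>L'. [:1, - x l:]) \<le> card L'" for L'
  proof (cases "finite L'")
    case True
    have "Polynomial.degree [:1, - x l:] \<le> 1" for l
      using degree_pCons_le[of 1 "[:- x l:]"] by (simp only: degree_pCons_0 One_nat_def)
    then have "(\<Sum>l\<in>L'. Polynomial.degree [:1, - x l:]) \<le> card L'"
      using sum_mono[of L' "\<lambda>l. Polynomial.degree [:1, - x l:]" "\<lambda>_. 1"] by simp
    then show ?thesis using degree_prod_sum_le[OF True, of "\<lambda>l. [:1, - x l:]"] by (simp add: o_def)
  qed simp
  have degN1: "Polynomial.degree (\<Prod>l\<in>L. [:- x l, 1:]) \<le> card L"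
    using degree_prod_sum_le[of L "\<lambda>l. [:- x l, 1:]"] fin by simp
  have "Polynomial.degree (smult (c j) ([:- x j, 1:] * (\<Prod>l\<in>L - {j}. [:1, - x l:]))) \<le> card L" if "j \<in> L" for j
  proof -
    have "Polynomial.degree ([:- x j, 1:] * (\<Prod>l\<in>L - {j}. [:1, - x l:])) \<le> 1 + card (L - {j})"
      by (rule order_trans[OF degree_mult_le]) (use degM[of "L - {j}"] in simp)
    also have "\<dots> = card L" using that fin card_Suc_Diff1 by fastforce
    finally show ?thesis using degree_smult_le order_trans by blast
  qed
  then have degN: "Polynomial.degree N \<le> card L"
    unfolding N_def using fin degN1 by (intro degree_diff_le degree_sum_le) auto
  have zero: "poly N (1 / x i) = 0" if i: "i \<in> L" for i
  proof -
    have nz: "x i \<noteq> 0" using x i by blast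
    have "(\<Sum>j\<in>L. c j * ((1 / x i - x j) * (\<Prod>l\<in>L - {j}. 1 - 1 / x i * x l))) =
        (\<Sum>j\<in>L. if j = i then c i * ((1 / x i - x i) * (\<Prod>l\<in>L - {i}. 1 - 1 / x i * x l)) else 0)"
    proof (rule sum.cong[OF refl])
      fix j assume "j \<in> L"
      have "(\<Prod>l\<in>L - {j}. 1 - 1 / x i * x l) = 0" if "j \<noteq> i"
        using that i fin nz by (intro prod_zero) auto
      then show "c j * ((1 / x i - x j) * (\<Prod>l\<in>L - {j}. 1 - 1 / x i * x l)) =
        (if j = i then c i * ((1 / x i - x i) * (\<Prod>l\<in>L - {i}. 1 - 1 / x i * x l)) else 0)"
        by auto
    qed
    also have "\<dots> = (1 / x i - x i) * (c i * (\<Prod>l\<in>L - {i}. 1 - 1 / x i * x l))"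
      using i fin by simp
    \<comment> \<open>\<open>c i\<close> is the interpolation coefficient that turns the only
      surviving summand into the product of the 1/x_i - x_l.\<close>
    also have "c i * (\<Prod>l\<in>L - {i}. 1 - 1 / x i * x l) = (\<Prod>l\<in>L - {i}. 1 / x i - x l)"
      unfolding c_def prod.distrib[symmetric]
    proof (rule prod.cong[OF refl])
      fix l assume "l \<in> L - {i}"
      then have "x i - x l \<noteq> 0" using inj i by (auto dest: inj_onD)
      then show "(1 - x i * x l) / (x i - x l) * (1 - 1 / x i * x l) = 1 / x i - x l"
        using nz by (simp add: divide_simps)
    qed
    finally show ?thesis unfolding N using i fin by (simp add: prod.remove)
  qed
  have N1: "poly N 1 = K * poly M 1"
  proof -
    have "(1 - x j) * (\<Prod>l\<in>L - {j}. 1 - 1 * x l) = (\<Prod>l\<in>L. 1 - x l)" if "j \<in> L" for j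
      using that fin by (simp add: prod.remove)
    then show ?thesis unfolding N M K_def by (simp add: left_diff_distrib sum_distrib_right)
  qed
  have N_1: "poly N (- 1) = - K * poly M (- 1)"
  proof -
    have "(- 1 - x j) * (\<Prod>l\<in>L - {j}. 1 - - 1 * x l) = - (\<Prod>l\<in>L. 1 + x l)" if "j \<in> L" for j
    proof -
      have "(\<Prod>l\<in>L. 1 + x l) = (1 + x j) * (\<Prod>l\<in>L - {j}. 1 - - 1 * x l)"
        using that fin by (simp add: prod.remove)
      then show ?thesis by (simp add: algebra_simps)
    qed
    moreover have "(\<Prod>l\<in>L. - 1 - x l) = - (\<Prod>l\<in>L. 1 + x l)"
    proof -
      have "(\<Prod>l\<in>L. - 1 - x l) = (\<Prod>l\<in>L. - 1 * (1 + x l))" by (rule prod.cong) auto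
      then show ?thesis using odd unfolding prod.distrib by simp
    qed
    ultimately show ?thesis unfolding N M K_def
      by (simp add: left_diff_distrib sum_distrib_right sum_negf)
  qed
  have eq: "N = smult K M"
  proof (rule poly_eqI_degree)
    let ?A = "insert 1 ((\<lambda>i. 1 / x i) ` L)"
    have "inj_on (\<lambda>i. 1 / x i) L" using inj x by (auto simp: inj_on_def field_simps)
    moreover have "1 \<notin> (\<lambda>i. 1 / x i) ` L" using x(2) by auto
    ultimately have card: "card ?A = Suc (card L)" using fin by (simp add: card_image)
    show "Polynomial.degree N < card ?A" using degN card by simp
    show "Polynomial.degree (smult K M) < card ?A"
      using degM[of L] degree_smult_le[of K M] unfolding card M_def by linarith
    fix s assume "s \<in> ?A"
    then consider "s = 1" | i where "i \<in> L" "s = 1 / x i" by blast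
    then show "poly N s = poly (smult K M) s"
    proof cases
      case 1
      then show ?thesis using N1 by simp
    next
      case 2
      then have "poly M s = 0" unfolding M using fin x(1) by (intro prod_zero) auto
      then show ?thesis using zero 2 by simp
    qed
  qed
  have "2 * (K * poly M (- 1)) = 0" using N_1 unfolding eq by simp
  moreover have "poly M (- 1) \<noteq> 0" unfolding M using fin x(3) by (auto simp: add_eq_0_iff)
  ultimately have "K = 0" using two by simp
  then have "poly N t = 0" using eq by simp
  then have Nt: "(\<Prod>l\<in>L. t - x l) = (\<Sum>j\<in>L. c j * ((t - x j) * (\<Prod>l\<in>L - {j}. 1 - t * x l)))"
    unfolding N by simp
  have nz: "(\<Prod>l\<in>L. 1 - t * x l) \<noteq> 0" using fin t by auto
  have "(\<Prod>l\<in>L. (t - x l) / (1 - t * x l)) = (\<Prod>l\<in>L. t - x l) / (\<Prod>l\<in>L. 1 - t * x l)"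
    by (rule prod_dividef)
  also have "\<dots> = (\<Sum>j\<in>L. c j * ((t - x j) * (\<Prod>l\<in>L - {j}. 1 - t * x l)) / (\<Prod>l\<in>L. 1 - t * x l))"
    unfolding Nt by (rule sum_divide_distrib)
  also have "\<dots> = (\<Sum>j\<in>L. (t - x j) / (1 - t * x j) * c j)"
  proof (rule sum.cong[OF refl])
    fix j assume j: "j \<in> L"
    have "(\<Prod>l\<in>L. 1 - t * x l) = (1 - t * x j) * (\<Prod>l\<in>L - {j}. 1 - t * x l)"
      using j fin by (simp add: prod.remove)
    moreover from this have "(\<Prod>l\<in>L - {j}. 1 - t * x l) \<noteq> 0" using nz by auto
    ultimately show "c j * ((t - x j) * (\<Prod>l\<in>L - {j}. 1 - t * x l)) / (\<Prod>l\<in>L. 1 - t * x l) =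
        (t - x j) / (1 - t * x j) * c j" by simp
  qed
  finally show ?thesis unfolding c_def .
qed

lemma to_fract_prod: "to_fract (\<Prod>i\<in>I. f i) = (\<Prod>i\<in>I. to_fract (f i))"
  by (induction I rule: infinite_finite_induct) auto

lemma to_fract_sum: "to_fract (\<Sum>i\<in>I. f i) = (\<Sum>i\<in>I. to_fract (f i))"
  by (induction I rule: infinite_finite_induct) auto

lemma to_fract_eq_mult_prod_divide:
  assumes "finite M" "T * (\<Prod>l\<in>M. d l) = K * (\<Prod>l\<in>M. n l)" "\<And>l. l \<in> M \<Longrightarrow> d l \<noteq> 0"
  shows "to_fract T = to_fract K * (\<Prod>l\<in>M. to_fract (n l) / to_fract (d l))"
proof -
  have "to_fract T * (\<Prod>l\<in>M. to_fract (d l)) = to_fract K * (\<Prod>l\<in>M. to_fract (n l))"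
    using arg_cong[OF assms(2), of to_fract] by (simp add: to_fract_prod)
  moreover have "(\<Prod>l\<in>M. to_fract (d l)) \<noteq> 0" using assms by auto
  ultimately show ?thesis by (simp add: prod_dividef field_simps)
qed

section \<open>The kernel of Q on a set of variables, and the terms of its expansions\<close>

definition pair_factor :: "nat \<Rightarrow> nat \<Rightarrow> 'a::comm_ring_1 laurent" where
  "pair_factor i j = (1 - var i * var_inv j) * (1 - var j * var_inv i) * inverse (1 - var i * var j)"

text \<open>The denominators are those of Littlewood's identity for the sum of all Schur functions.
  Arbitrary index sets are allowed so that variables can be split off; as \<open>pair_factor\<close>
  is symmetric, i < j only selects a representative of each pair.\<close>

definition littlewood_kernel :: "nat set \<Rightarrow> 'a::comm_ring_1 laurent" where
  "littlewood_kernel L = (\<Prod>i\<in>L. inverse (1 - var i)) *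
     (\<Prod>(i, j)\<in>{(i, j). i \<in> L \<and> j \<in> L \<and> i < j}. pair_factor i j)"

lemma pair_factor_commute: "pair_factor i j = pair_factor j i"
  by (simp add: pair_factor_def mult_ac)

lemma littlewood_kernel_empty [simp]: "littlewood_kernel {} = 1"
  by (simp add: littlewood_kernel_def)

lemma littlewood_kernel_insert:
  assumes fin: "finite L" and a: "a \<notin> L"
  shows "littlewood_kernel (insert a L) = inverse (1 - var a) * (\<Prod>l\<in>L. pair_factor a l) * littlewood_kernel L"
proof -
  \<comment> \<open>\<open>?m\<close> sends l to the ordered representative of the pair formed by a
    and l.\<close>
  let ?P = "\<lambda>L :: nat set. {(i, j). i \<in> L \<and> j \<in> L \<and> i < j}" and ?m = "\<lambda>l. (min a l, max a l)"
  have "?P (insert a L) = ?m ` L \<union> ?P L"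
  proof (intro equalityI subsetI)
    fix p assume p: "p \<in> ?P (insert a L)"
    obtain i j where ij: "p = (i, j)" by fastforce
    consider "i = a" | "j = a" | "p \<in> ?P L" using p ij by auto
    then show "p \<in> ?m ` L \<union> ?P L"
    proof cases
      case 1
      then have "p = ?m j" "j \<in> L" using p ij by auto
      then show ?thesis by blast
    next
      case 2
      then have "p = ?m i" "i \<in> L" using p ij by auto
      then show ?thesis by blast
    qed simp
  next
    fix p assume "p \<in> ?m ` L \<union> ?P L"
    then show "p \<in> ?P (insert a L)" using a by (cases p) (auto simp: min_def max_def less_le split: if_splits)
  qed
  moreover have "finite (?P L)" by (rule finite_subset[of _ "L \<times> L"]) (use fin in auto)
  moreover have "?m ` L \<inter> ?P L = {}" using a by (auto simp: min_def max_def split: if_splits)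
  ultimately have "(\<Prod>(i, j)\<in>?P (insert a L). pair_factor i j) =
      (\<Prod>(i, j)\<in>?m ` L. pair_factor i j) * (\<Prod>(i, j)\<in>?P L. pair_factor i j :: 'a laurent)"
    using fin by (simp add: prod.union_disjoint)
  also have "(\<Prod>(i, j)\<in>?m ` L. pair_factor i j) = (\<Prod>l\<in>L. pair_factor a l :: 'a laurent)"
  proof (subst prod.reindex)
    show "inj_on ?m L" by (auto simp: inj_on_def min_def max_def split: if_splits)
    show "prod ((\<lambda>(i, j). pair_factor i j) \<circ> ?m) L = (\<Prod>l\<in>L. pair_factor a l :: 'a laurent)"
      by (rule prod.cong) (auto simp: min_def max_def pair_factor_commute)
  qed
  finally show ?thesis using fin a by (simp add: littlewood_kernel_def mult_ac)
qed

lemma littlewood_kernel_remove: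
  assumes "finite L" "a \<in> L"
  shows "littlewood_kernel L = inverse (1 - var a) * (\<Prod>l\<in>L - {a}. pair_factor a l) * littlewood_kernel (L - {a})"
  using littlewood_kernel_insert[of "L - {a}" a] assms by (simp add: insert_absorb)

lemma rename_vars_var_inv [simp]:
  "bij \<pi> \<Longrightarrow> rename_vars \<pi> (var_inv i) = (var_inv (\<pi> i) :: 'a::comm_ring_1 laurent)"
  by (simp add: rename_vars_inverse)

lemma rename_vars_inverse_one_minus_var [simp]:
  "bij \<pi> \<Longrightarrow> rename_vars \<pi> (inverse (1 - var i)) = (inverse (1 - var (\<pi> i)) :: 'a::comm_ring_1 laurent)"
  by (simp add: rename_vars_inverse rename_vars_diff)

lemma rename_vars_pair_factor [simp]:
  "bij \<pi> \<Longrightarrow> rename_vars \<pi> (pair_factor i j) = (pair_factor (\<pi> i) (\<pi> j) :: 'a::comm_ring_1 laurent)"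
  by (simp add: pair_factor_def rename_vars_inverse rename_vars_diff rename_vars_mult)

lemma rename_vars_littlewood_kernel:
  assumes "bij \<pi>" "finite L"
  shows "rename_vars \<pi> (littlewood_kernel L) = (littlewood_kernel (\<pi> ` L) :: 'a::comm_ring_1 laurent)"
  using assms(2)
proof (induction L)
  case (insert a L)
  have inj: "inj_on \<pi> A" for A using assms(1) by (meson bij_is_inj inj_on_subset subset_UNIV)
  have "\<pi> a \<notin> \<pi> ` L" using insert assms(1) by (auto simp: bij_is_inj inj_eq)
  then show ?case using insert assms(1) inj
    by (simp add: littlewood_kernel_insert rename_vars_mult rename_vars_prod prod.reindex)
qed (use assms in simp)

text \<open>In the fraction field, for j in L, this is \<open>littlewood_kernel L\<close> times the
  product of (1 - x_j x_l)/(x_j - x_l). The form given lies in the ring, and its cross factors are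
  polynomial in the inverse variables.\<close>

definition peel_one :: "nat set \<Rightarrow> nat \<Rightarrow> 'a::comm_ring_1 laurent" where
  "peel_one L j = littlewood_kernel (L - {j}) * inverse (1 - var j) * (\<Prod>l\<in>L - {j}. var_inv j - var_inv l)"

text \<open>One term of the expansion along row a. The remaining variables keep their full kernel,
  so the expansion can be iterated on them.\<close>

definition peel_two :: "nat set \<Rightarrow> nat \<Rightarrow> nat \<Rightarrow> 'a::comm_ring_1 laurent" where
  "peel_two L a j = littlewood_kernel (L - {a, j}) * (inverse (1 - var a) * inverse (1 - var j) * pair_factor a j) *
     (\<Prod>l\<in>L - {a, j}. (var_inv a - var_inv l) * (var_inv j - var_inv l))"

lemma rename_vars_peel_one:
  assumes "bij \<pi>" "finite L"
  shows "rename_vars \<pi> (peel_one L j) = (peel_one (\<pi> ` L) (\<pi> j) :: 'a::comm_ring_1 laurent)"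
proof -
  have inj: "inj_on \<pi> A" for A using assms(1) by (meson bij_is_inj inj_on_subset subset_UNIV)
  have "\<pi> ` L - {\<pi> j} = \<pi> ` (L - {j})" using inj[of UNIV] by (auto simp: inj_eq)
  then show ?thesis using assms inj
    by (simp add: peel_one_def rename_vars_mult rename_vars_littlewood_kernel rename_vars_prod rename_vars_diff prod.reindex)
qed

lemma rename_vars_peel_two:
  assumes "bij \<pi>" "finite L"
  shows "rename_vars \<pi> (peel_two L a j) = (peel_two (\<pi> ` L) (\<pi> a) (\<pi> j) :: 'a::comm_ring_1 laurent)"
proof -
  have inj: "inj_on \<pi> A" for A using assms(1) by (meson bij_is_inj inj_on_subset subset_UNIV)
  have "\<pi> ` L - {\<pi> a, \<pi> j} = \<pi> ` (L - {a, j})" using inj[of UNIV] by (auto simp: inj_eq)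
  then show ?thesis using assms inj
    by (simp add: peel_two_def rename_vars_mult rename_vars_littlewood_kernel rename_vars_prod rename_vars_diff prod.reindex)
qed

text \<open>Both sides equal 2 - x_j/x_l - x_l/x_j. This is what exchanges a denominator x_j - x_l
  for a difference of inverse variables.\<close>

lemma var_inv_diff_mult_var_diff:
  "(var_inv j - var_inv l) * (var j - var l) = pair_factor j l * (1 - var j * var l :: 'a::comm_ring_1 laurent)"
proof -
  have "pair_factor j l * (1 - var j * var l) = (1 - var j * var_inv l) * (1 - var l * var_inv j) *
     ((1 - var j * var l) * inverse (1 - var j * var l) :: 'a laurent)"
    unfolding pair_factor_def by (simp only: mult_ac)
  also have "\<dots> = (1 - var j * var_inv l) * (1 - var l * var_inv j)" by simp
  also have "\<dots> = 1 - var j * var_inv l - var l * var_inv j + (var j * var_inv j) * (var l * var_inv l)"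
    by (simp only: algebra_simps mult_1_left mult_1_right)
  also have "\<dots> = (var j * var_inv j) + (var l * var_inv l) - var j * var_inv l - var l * var_inv j" by simp
  also have "\<dots> = (var_inv j - var_inv l) * (var j - var l)" by (simp only: algebra_simps)
  finally show ?thesis ..
qed

lemma peel_one_mult_prod:
  assumes "finite L" "j \<in> L"
  shows "peel_one L j * (\<Prod>l\<in>L - {j}. var j - var l) = littlewood_kernel L * (\<Prod>l\<in>L - {j}. 1 - var j * var l)"
proof -
  have "(\<Prod>l\<in>L - {j}. var_inv j - var_inv l) * (\<Prod>l\<in>L - {j}. var j - var l) =
      (\<Prod>l\<in>L - {j}. pair_factor j l) * (\<Prod>l\<in>L - {j}. 1 - var j * var l :: 'a laurent)"
    unfolding prod.distrib[symmetric] by (simp only: var_inv_diff_mult_var_diff)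
  then show ?thesis unfolding peel_one_def littlewood_kernel_remove[OF assms] by (simp add: mult_ac)
qed

lemma peel_two_mult_prod:
  assumes "finite L" "a \<in> L" "j \<in> L" "a \<noteq> j"
  shows "peel_two L a j * (\<Prod>l\<in>L - {a, j}. (var a - var l) * (var j - var l)) =
    littlewood_kernel L * (\<Prod>l\<in>L - {a, j}. (1 - var a * var l) * (1 - var j * var l))"
proof -
  have k: "L - {a} - {j} = L - {a, j}" by blast
  have "littlewood_kernel L = inverse (1 - var a) * (\<Prod>l\<in>L - {a}. pair_factor a l) *
      (inverse (1 - var j) * (\<Prod>l\<in>L - {a, j}. pair_factor j l) * littlewood_kernel (L - {a, j}) :: 'a laurent)"
    using littlewood_kernel_remove[of L a, where 'a = 'a]
      littlewood_kernel_remove[of "L - {a}" j, where 'a = 'a] assms by (simp add: k)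
  moreover have "(\<Prod>l\<in>L - {a}. pair_factor a l) = pair_factor a j * (\<Prod>l\<in>L - {a, j}. pair_factor a l :: 'a laurent)"
    using assms prod.remove[of "L - {a}" j] by (simp add: k)
  moreover have "(\<Prod>l\<in>L - {a, j}. (var_inv a - var_inv l) * (var_inv j - var_inv l)) *
        (\<Prod>l\<in>L - {a, j}. (var a - var l) * (var j - var l)) =
      (\<Prod>l\<in>L - {a, j}. ((var_inv a - var_inv l) * (var a - var l)) * ((var_inv j - var_inv l) * (var j - var l)) :: 'a laurent)"
    unfolding prod.distrib[symmetric] by (simp only: mult_ac)
  moreover have "\<dots> = (\<Prod>l\<in>L - {a, j}. pair_factor a l) * (\<Prod>l\<in>L - {a, j}. pair_factor j l) *
      (\<Prod>l\<in>L - {a, j}. (1 - var a * var l) * (1 - var j * var l))"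
    unfolding var_inv_diff_mult_var_diff prod.distrib by (simp only: mult_ac)
  ultimately show ?thesis unfolding peel_two_def by (simp add: mult_ac)
qed

section \<open>The expansions, proved in the fraction field\<close>

lemma var_eq_iff [simp]: "var i = (var j :: 'a::comm_ring_1 laurent) \<longleftrightarrow> i = j"
proof
  assume "var i = (var j :: 'a laurent)"
  then have "coeff_laurent (var i :: 'a laurent) (Poly_Mapping.single i 1) =
      coeff_laurent (var j) (Poly_Mapping.single i 1)" by simp
  then have "Poly_Mapping.single i (1::int) = Poly_Mapping.single j 1"
    by (simp add: var_def split: if_splits)
  then show "i = j" by (metis lookup_single_eq lookup_single_not_eq zero_neq_one)
qed simp

lemma var_neq_const:
  "var i \<noteq> (0 :: 'a::comm_ring_1 laurent)" "var i \<noteq> (1 :: 'a laurent)" "var i \<noteq> (- 1 :: 'a laurent)"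
  "var i * var j \<noteq> (1 :: 'a laurent)"
proof -
  let ?d = "Poly_Mapping.single i 1 + Poly_Mapping.single j (1::int)"
  have *: "Poly_Mapping.single i (1::int) \<noteq> 0" by (metis lookup_single_eq lookup_zero zero_neq_one)
  have "Poly_Mapping.lookup ?d i \<noteq> 0" by (simp add: lookup_add lookup_single when_def)
  then have "?d \<noteq> 0" by force
  then have "coeff_laurent (var i * var j :: 'a laurent) ?d \<noteq> coeff_laurent 1 ?d"
    by (simp add: var_def monom_times_monom)
  then show "var i * var j \<noteq> (1 :: 'a laurent)" by metis
  have c: "coeff_laurent (var i :: 'a laurent) (Poly_Mapping.single i 1) = 1" by (simp add: var_def)
  have "coeff_laurent (x :: 'a laurent) (Poly_Mapping.single i 1) = 0" if "x = 0 \<or> x = 1 \<or> x = - 1" for x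
    using that * by auto
  then show "var i \<noteq> (0 :: 'a laurent)" "var i \<noteq> (1 :: 'a laurent)" "var i \<noteq> (- 1 :: 'a laurent)"
    using c by force+
qed

lemma two_neq_zero_fract_laurent: "(2 :: 'a::{idom,ring_char_0} laurent fract) \<noteq> 0"
proof -
  have "coeff_laurent (1 + 1 :: 'a laurent) 0 \<noteq> coeff_laurent 0 0" unfolding coeff_laurent_simps by simp
  then have "to_fract (1 + 1 :: 'a laurent) \<noteq> 0" unfolding to_fract_eq_0_iff by metis
  then show ?thesis unfolding to_fract_add by (simp add: one_add_one)
qed

text \<open>The next two lemmas are Pfaffian expansions of Schur's identity
  $\prod_{i<j} \frac{x_i - x_j}{1 - x_i x_j} = \mathrm{Pf}\bigl(\frac{x_i - x_j}{1 - x_i x_j}\bigr)$,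
  with both sides multiplied by an alternating factor so that no signs occur.\<close>

lemma littlewood_kernel_eq_sum_peel_one:
  assumes fin: "finite L" and odd: "odd (card L)"
  shows "littlewood_kernel L = (\<Sum>j\<in>L. peel_one L j :: 'a::{idom,ring_char_0} laurent)"
proof -
  let ?x = "\<lambda>i. to_fract (var i :: 'a laurent)" and ?F = "to_fract :: 'a laurent \<Rightarrow> _"
  have c: "?x i \<noteq> 0" "?x i \<noteq> 1" "?x i \<noteq> - 1" for i
    using var_neq_const[of i] to_fract_eq_iff[of "var i" 1] to_fract_eq_iff[of "var i" "- 1"] by auto
  have "?F (peel_one L j) = ?F (littlewood_kernel L) * (\<Prod>l\<in>L - {j}. (1 - ?x j * ?x l) / (?x j - ?x l))" if "j \<in> L" for j
    using to_fract_eq_mult_prod_divide[OF _ peel_one_mult_prod[OF fin that]] fin by auto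
  then have "?F (\<Sum>j\<in>L. peel_one L j) =
      ?F (littlewood_kernel L) * (\<Sum>j\<in>L. (\<Prod>l\<in>L - {j}. (1 - ?x j * ?x l) / (?x j - ?x l)))"
    by (simp add: to_fract_sum sum_distrib_left)
  \<comment> \<open>The inserted quotients are 1; they give the sum the shape of
    \<open>partial_fractions_odd\<close> at t = 1, where the product side is 1 as well.\<close>
  also have "(\<Sum>j\<in>L. (\<Prod>l\<in>L - {j}. (1 - ?x j * ?x l) / (?x j - ?x l))) =
      (\<Sum>j\<in>L. (1 - ?x j) / (1 - 1 * ?x j) * (\<Prod>l\<in>L - {j}. (1 - ?x j * ?x l) / (?x j - ?x l)))"
    using c(2) by (intro sum.cong) auto
  also have "\<dots> = (\<Prod>l\<in>L. (1 - ?x l) / (1 - 1 * ?x l))"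
    using c by (intro partial_fractions_odd[symmetric] fin odd two_neq_zero_fract_laurent) (auto simp: inj_on_def)
  also have "\<dots> = 1" using c(2) by (intro prod.neutral) auto
  finally show ?thesis unfolding mult_1_right to_fract_eq_iff by (rule sym)
qed

lemma littlewood_kernel_eq_sum_peel_two:
  assumes fin: "finite L" and even: "even (card L)" and a: "a \<in> L"
  shows "littlewood_kernel L = (\<Sum>j\<in>L - {a}. peel_two L a j :: 'a::{idom,ring_char_0} laurent)"
proof -
  let ?x = "\<lambda>i. to_fract (var i :: 'a laurent)" and ?F = "to_fract :: 'a laurent \<Rightarrow> _"
  let ?s = "\<lambda>l. (?x a - ?x l) / (1 - ?x a * ?x l)" and ?c = "\<lambda>j l. (1 - ?x j * ?x l) / (?x j - ?x l)"
  have c: "?x i \<noteq> 0" "?x i \<noteq> 1" "?x i \<noteq> - 1" "?x i * ?x j \<noteq> 1" for i j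
    using var_neq_const[of i] var_neq_const(4)[of i j] to_fract_eq_iff[of "var i" 1]
      to_fract_eq_iff[of "var i" "- 1"] to_fract_eq_iff[of "var i * var j" 1] by auto
  have nz: "?s l \<noteq> 0" if "l \<in> L - {a}" for l using c(4)[of a l] that by auto
  have card: "odd (card (L - {a}))" using even a fin by (metis card_Suc_Diff1 even_Suc)
  have nzp: "(\<Prod>l\<in>L - {a}. ?s l) \<noteq> 0" using nz fin by auto
  \<comment> \<open>Since \<open>?c a l\<close> is the reciprocal of \<open>?s l\<close>,
    multiplying by the product of row a removes all factors that pair a with an index other than j.
    What remains is a summand of \<open>partial_fractions_odd\<close> at t = x_a.\<close>
  have "?F (peel_two L a j) * (\<Prod>l\<in>L - {a}. ?s l) =
      ?F (littlewood_kernel L) * (?s j * (\<Prod>l\<in>L - {a} - {j}. ?c j l))" if j: "j \<in> L - {a}" for j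
  proof -
    have "?F (peel_two L a j) = ?F (littlewood_kernel L) *
        (\<Prod>l\<in>L - {a, j}. ?F ((1 - var a * var l) * (1 - var j * var l)) / ?F ((var a - var l) * (var j - var l)))"
      using j by (intro to_fract_eq_mult_prod_divide[OF _ peel_two_mult_prod]) (auto simp: fin a)
    also have "\<dots> = ?F (littlewood_kernel L) * (\<Prod>l\<in>L - {a} - {j}. ?c a l * ?c j l)"
      by (intro arg_cong2[where f = "(*)"] refl prod.cong) auto
    finally have "?F (peel_two L a j) * (\<Prod>l\<in>L - {a}. ?s l) =
        ?F (littlewood_kernel L) * (?s j * (\<Prod>l\<in>L - {a} - {j}. (?c a l * ?s l) * ?c j l))"
      using prod.remove[of "L - {a}" j ?s] j fin by (simp only: finite_Diff prod.distrib mult_ac)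
    also have "(\<Prod>l\<in>L - {a} - {j}. (?c a l * ?s l) * ?c j l) = (\<Prod>l\<in>L - {a} - {j}. ?c j l)"
      using nz c(4)[of a] by (intro prod.cong) auto
    finally show ?thesis .
  qed
  then have "?F (\<Sum>j\<in>L - {a}. peel_two L a j) * (\<Prod>l\<in>L - {a}. ?s l) =
      ?F (littlewood_kernel L) * (\<Sum>j\<in>L - {a}. ?s j * (\<Prod>l\<in>L - {a} - {j}. ?c j l))"
    unfolding to_fract_sum sum_distrib_right sum_distrib_left by (rule sum.cong[OF refl])
  also have "(\<Sum>j\<in>L - {a}. ?s j * (\<Prod>l\<in>L - {a} - {j}. ?c j l)) = (\<Prod>l\<in>L - {a}. ?s l)"
    using c fin by (intro partial_fractions_odd[symmetric] card two_neq_zero_fract_laurent) (auto simp: inj_on_def)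
  finally have "?F (\<Sum>j\<in>L - {a}. peel_two L a j) = ?F (littlewood_kernel L)"
    using nzp by (rule mult_right_cancel[THEN iffD1, rotated])
  then show ?thesis unfolding to_fract_eq_iff by (rule sym)
qed

text \<open>Exchanging j and b turns the term of b into the term of j and fixes R. So all terms of
  the expansion have the same constant term, and counting them gives the factor.\<close>

lemma CT_littlewood_kernel_peel_one:
  fixes R :: "'a::{idom,ring_char_0} laurent"
  assumes fin: "finite L" and odd: "odd (card L)" and b: "b \<in> L"
    and R: "\<And>i j. i \<in> L \<Longrightarrow> j \<in> L \<Longrightarrow> rename_vars (Transposition.transpose i j) R = R"
  shows "CT (littlewood_kernel L * R) = of_nat (card L) * CT (peel_one L b * R)"
proof -
  have "CT (peel_one L j * R) = CT (peel_one L b * R)" if j: "j \<in> L" for j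
  proof -
    let ?\<tau> = "Transposition.transpose j b"
    have "?\<tau> ` L = L" using b j by simp
    then have "rename_vars ?\<tau> (peel_one L b * R) = peel_one L j * R"
      using R[OF j b] by (simp add: rename_vars_mult rename_vars_peel_one fin)
    then show ?thesis using CT_rename_vars[of ?\<tau> "peel_one L b * R"] by simp
  qed
  then show ?thesis
    by (simp add: littlewood_kernel_eq_sum_peel_one[OF fin odd] sum_distrib_right CT_sum)
qed

text \<open>The transposition now has to fix the row index a as well; a has card L - 1 possible
  partners.\<close>

lemma CT_littlewood_kernel_peel_two:
  fixes R :: "'a::{idom,ring_char_0} laurent"
  assumes fin: "finite L" and even: "even (card L)" and a: "a \<in> L" and b: "b \<in> L" and "a \<noteq> b"
    and R: "\<And>i j. i \<in> L \<Longrightarrow> j \<in> L \<Longrightarrow> rename_vars (Transposition.transpose i j) R = R"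
  shows "CT (littlewood_kernel L * R) = of_nat (card L - 1) * CT (peel_two L a b * R)"
proof -
  have "CT (peel_two L a j * R) = CT (peel_two L a b * R)" if j: "j \<in> L - {a}" for j
  proof -
    let ?\<tau> = "Transposition.transpose j b"
    have "?\<tau> ` L = L" using b j by simp
    moreover have "?\<tau> a = a" using j \<open>a \<noteq> b\<close> by (simp add: Transposition.transpose_def)
    ultimately have "rename_vars ?\<tau> (peel_two L a b * R) = peel_two L a j * R"
      using R[of j b] j b by (simp add: rename_vars_mult rename_vars_peel_two fin)
    then show ?thesis using CT_rename_vars[of ?\<tau> "peel_two L a b * R"] by simp
  qed
  then show ?thesis using a fin
    by (simp add: littlewood_kernel_eq_sum_peel_two[OF fin even a] sum_distrib_right CT_sum card_Diff_singleton)
qed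

section \<open>Specialization of paired variables\<close>

definition monom_eval :: "(nat \<Rightarrow> 'a::comm_ring_1 laurent) \<Rightarrow> (nat \<Rightarrow>\<^sub>0 nat) \<Rightarrow> 'a laurent" where
  "monom_eval y m = (\<Prod>i\<in>Poly_Mapping.keys m. y i ^ Poly_Mapping.lookup m i)"

lemma monom_eval_eq_prod:
  assumes "finite A" "\<And>i. i \<in> Poly_Mapping.keys m \<Longrightarrow> i \<notin> A \<Longrightarrow> y i = 1"
  shows "monom_eval y m = (\<Prod>i\<in>A. y i ^ Poly_Mapping.lookup m i)"
proof -
  have "monom_eval y m = (\<Prod>i\<in>A \<union> Poly_Mapping.keys m. y i ^ Poly_Mapping.lookup m i)"
    unfolding monom_eval_def by (rule prod.mono_neutral_left) (auto simp: assms in_keys_iff)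
  also have "\<dots> = (\<Prod>i\<in>A. y i ^ Poly_Mapping.lookup m i)"
    by (rule prod.mono_neutral_right) (auto simp: assms)
  finally show ?thesis .
qed

lemma monom_eval_add: "monom_eval y (m + m') = monom_eval y m * monom_eval y m'"
proof -
  let ?A = "Poly_Mapping.keys m \<union> Poly_Mapping.keys m'"
  have "monom_eval y (m + m') = (\<Prod>i\<in>?A. y i ^ Poly_Mapping.lookup (m + m') i)"
    using Poly_Mapping.keys_add[of m m'] by (intro monom_eval_eq_prod) auto
  moreover have "monom_eval y m = (\<Prod>i\<in>?A. y i ^ Poly_Mapping.lookup m i)"
    by (intro monom_eval_eq_prod) auto
  moreover have "monom_eval y m' = (\<Prod>i\<in>?A. y i ^ Poly_Mapping.lookup m' i)"
    by (intro monom_eval_eq_prod) auto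
  ultimately show ?thesis by (simp add: lookup_add power_add prod.distrib)
qed

lemma subst_poly_eq_sum:
  assumes "finite A" "Poly_Mapping.keys P \<subseteq> A"
  shows "subst_poly P y = (\<Sum>m\<in>A. const_laurent (Poly_Mapping.lookup P m) * monom_eval y m)"
  unfolding subst_poly_def monom_eval_def
  by (rule sum.mono_neutral_left) (use assms in \<open>auto simp: in_keys_iff const_laurent_simps\<close>)

lemma subst_poly_add: "subst_poly (P + Q) y = subst_poly P y + subst_poly Q y"
proof -
  let ?A = "Poly_Mapping.keys P \<union> Poly_Mapping.keys Q"
  have "subst_poly (P + Q) y = (\<Sum>m\<in>?A. const_laurent (Poly_Mapping.lookup (P + Q) m) * monom_eval y m)"
    using Poly_Mapping.keys_add[of P Q] by (intro subst_poly_eq_sum) auto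
  then show ?thesis
    by (simp add: subst_poly_eq_sum[of ?A P] subst_poly_eq_sum[of ?A Q] lookup_add const_laurent_simps
        distrib_right sum.distrib)
qed

lemma subst_poly_single: "subst_poly (Poly_Mapping.single m c) y = const_laurent c * monom_eval y m"
  by (subst subst_poly_eq_sum[of "{m}"]) auto

lemma subst_poly_sum: "subst_poly (\<Sum>i\<in>I. P i) y = (\<Sum>i\<in>I. subst_poly (P i) y)"
proof (induction I rule: infinite_finite_induct)
  have "subst_poly 0 y = 0" by (simp add: subst_poly_def)
  then show "subst_poly (\<Sum>i\<in>{}. P i) y = (\<Sum>i\<in>{}. subst_poly (P i) y)"
    "infinite A \<Longrightarrow> subst_poly (\<Sum>i\<in>A. P i) y = (\<Sum>i\<in>A. subst_poly (P i) y)" for A by simp_all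
qed (simp add: subst_poly_add)

lemma poly_mapping_eq_sum_single:
  "P = (\<Sum>m\<in>Poly_Mapping.keys P. Poly_Mapping.single m (Poly_Mapping.lookup P m))"
  by (rule poly_mapping_eqI) (simp add: lookup_sum lookup_single when_def in_keys_iff sum.delta)

lemma subst_poly_mult: "subst_poly (P * Q) y = subst_poly P y * subst_poly Q y"
proof -
  let ?c = "Poly_Mapping.lookup"
  have "P * Q = (\<Sum>m\<in>Poly_Mapping.keys P. Poly_Mapping.single m (?c P m)) *
      (\<Sum>m\<in>Poly_Mapping.keys Q. Poly_Mapping.single m (?c Q m))"
    by (simp only: poly_mapping_eq_sum_single[symmetric])
  also have "\<dots> = (\<Sum>m\<in>Poly_Mapping.keys P. \<Sum>m'\<in>Poly_Mapping.keys Q. Poly_Mapping.single (m + m') (?c P m * ?c Q m'))"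
    by (simp add: sum_product mult_single)
  finally show ?thesis
    by (simp add: subst_poly_sum subst_poly_single subst_poly_eq_sum[OF _ subset_refl] sum_product
        monom_eval_add const_laurent_simps mult_ac)
qed

text \<open>Multiplicativity allows the cross factors to be multiplied into P as polynomials, before
  any point is chosen.\<close>

lemma comm_ring_hom_subst_poly: "comm_ring_hom (\<lambda>P. subst_poly P y)"
proof
  show "subst_poly 1 y = 1"
    using subst_poly_single[of 0 1 y] by (simp add: const_laurent_simps monom_eval_def)
  show "subst_poly 0 y = 0" by (simp add: subst_poly_def)
qed (rule subst_poly_add subst_poly_mult)+

interpretation subst_hom: comm_ring_hom "\<lambda>P. subst_poly P y" for y
  by (rule comm_ring_hom_subst_poly)

definition poly_var :: "nat \<Rightarrow> (nat \<Rightarrow>\<^sub>0 nat) \<Rightarrow>\<^sub>0 'a::comm_ring_1" where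
  "poly_var i = Poly_Mapping.single (Poly_Mapping.single i 1) 1"

lemma subst_poly_var [simp]: "subst_poly (poly_var i) y = y i"
  by (simp add: poly_var_def subst_poly_single const_laurent_simps monom_eval_def)

lemma rename_vars_subst_poly:
  assumes "bij \<pi>"
  shows "rename_vars \<pi> (subst_poly P y) = subst_poly P (\<lambda>i. rename_vars \<pi> (y i))"
  by (simp add: subst_poly_def assms rename_vars_sum rename_vars_mult rename_vars_prod rename_vars_power)

text \<open>Permuting the entries of the point amounts to permuting the exponents, which leaves the
  coefficients of P unchanged.\<close>

lemma symmetric_poly_subst_permute:
  assumes P: "symmetric_poly n P" and \<pi>: "\<pi> permutes {1..n}"
  shows "subst_poly P (\<lambda>i. y (\<pi> i)) = subst_poly P y"
proof -
  let ?k = "Poly_Mapping.map_key \<pi> :: _ \<Rightarrow> nat \<Rightarrow>\<^sub>0 nat"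
  let ?k' = "Poly_Mapping.map_key (Hilbert_Choice.inv \<pi>) :: _ \<Rightarrow> nat \<Rightarrow>\<^sub>0 nat"
  have bij: "bij \<pi>" using \<pi> by (rule permutes_bij)
  have inv: "?k' (?k m) = m" "?k (?k' m) = m" for m using map_key_eq_iff[OF bij] by metis+
  have lk: "Poly_Mapping.lookup P (?k m) = Poly_Mapping.lookup P m" for m
    using P \<pi> by (auto simp: symmetric_poly_def)
  have lk': "Poly_Mapping.lookup P (?k' m) = Poly_Mapping.lookup P m" for m
    using lk[of "?k' m"] by (simp add: inv)
  have mon: "monom_eval (\<lambda>i. y (\<pi> i)) (?k m) = monom_eval y m" for m
    unfolding monom_eval_def using bij
    by (intro prod.reindex_bij_witness[of _ "Hilbert_Choice.inv \<pi>" \<pi>])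
      (auto simp: keys_map_key map_key.rep_eq bij_is_inj bij_is_surj surj_f_inv_f)
  have "(\<Sum>m\<in>Poly_Mapping.keys P. const_laurent (Poly_Mapping.lookup P m) * monom_eval (\<lambda>i. y (\<pi> i)) m) =
      (\<Sum>m\<in>Poly_Mapping.keys P. const_laurent (Poly_Mapping.lookup P m) * monom_eval y m)"
    by (rule sum.reindex_bij_witness[of _ ?k ?k'])
      (auto simp: inv in_keys_iff lk lk' mon[symmetric])
  then show ?thesis by (simp add: subst_poly_eq_sum[OF _ subset_refl])
qed

lemma subst_poly_cong:
  assumes "\<And>m i. m \<in> Poly_Mapping.keys P \<Longrightarrow> i \<in> Poly_Mapping.keys m \<Longrightarrow> y i = z i"
  shows "subst_poly P y = subst_poly P z"
  unfolding subst_poly_def by (intro sum.cong prod.cong refl arg_cong2[where f = "(*)"]) (simp add: assms)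

section \<open>Series in separate groups of variables\<close>

definition laurent_in :: "nat set \<Rightarrow> 'a::zero laurent \<Rightarrow> bool" where
  "laurent_in S f \<longleftrightarrow> (\<forall>e. coeff_laurent f e \<noteq> 0 \<longrightarrow> Poly_Mapping.keys e \<subseteq> S)"

lemma laurent_in_mult:
  fixes f g :: "'a::comm_ring_1 laurent"
  assumes "laurent_in S f" "laurent_in S g"
  shows "laurent_in S (f * g)"
  unfolding laurent_in_def
proof (intro allI impI)
  fix e assume "coeff_laurent (f * g) e \<noteq> 0"
  then obtain a where "coeff_laurent f a \<noteq> 0" "coeff_laurent g (e - a) \<noteq> 0"
    unfolding times_laurent.rep_eq by (auto elim: sum.not_neutral_contains_not_neutral)
  then have "Poly_Mapping.keys (a + (e - a)) \<subseteq> S"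
    using assms by (intro keys_add_subset) (auto simp: laurent_in_def)
  then show "Poly_Mapping.keys e \<subseteq> S" by simp
qed

lemma laurent_in_monom: "Poly_Mapping.keys d \<subseteq> S \<Longrightarrow> laurent_in S (monom_laurent c d :: 'a::comm_ring_1 laurent)"
  by (auto simp: laurent_in_def split: if_splits)

lemma laurent_in_1: "laurent_in S (1 :: 'a::comm_ring_1 laurent)"
  using laurent_in_monom[of 0 S 1] by (simp add: one_laurent_def)

lemma laurent_in_add: "laurent_in S f \<Longrightarrow> laurent_in S g \<Longrightarrow> laurent_in S (f + g :: 'a::comm_ring_1 laurent)"
  unfolding laurent_in_def coeff_laurent_simps by (metis add_0)

lemma laurent_in_diff: "laurent_in S f \<Longrightarrow> laurent_in S g \<Longrightarrow> laurent_in S (f - g :: 'a::comm_ring_1 laurent)"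
  unfolding laurent_in_def coeff_laurent_simps by (metis diff_0_right)

lemma laurent_in_power: "laurent_in S f \<Longrightarrow> laurent_in S (f ^ n :: 'a::comm_ring_1 laurent)"
  by (induction n) (auto intro: laurent_in_1 laurent_in_mult)

lemma laurent_in_var: "i \<in> S \<Longrightarrow> laurent_in S (var i :: 'a::comm_ring_1 laurent)"
  unfolding var_def by (rule laurent_in_monom) simp

lemma laurent_in_var_inv: "i \<in> S \<Longrightarrow> laurent_in S (var_inv i :: 'a::comm_ring_1 laurent)"
  unfolding laurent_inverse_var by (rule laurent_in_monom) simp

lemma laurent_in_inverse_one_minus_var: "i \<in> S \<Longrightarrow> laurent_in S (inverse (1 - var i) :: 'a::comm_ring_1 laurent)"
  unfolding laurent_in_def coeff_inverse_one_minus_var by (auto split: if_splits)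

lemma laurent_in_inverse_one_minus_var_mult:
  assumes "i \<in> S" "j \<in> S"
  shows "laurent_in S (inverse (1 - var i * var j) :: 'a::comm_ring_1 laurent)"
  unfolding laurent_in_def coeff_inverse_one_minus_var_mult
proof (intro allI impI)
  fix e assume "(if \<exists>k::nat. e = Poly_Mapping.single i (int k) + Poly_Mapping.single j (int k) then 1 else 0 :: 'a) \<noteq> 0"
  then obtain k where "e = Poly_Mapping.single i (int k) + Poly_Mapping.single j (int k)"
    by (auto split: if_splits)
  moreover have "Poly_Mapping.keys (Poly_Mapping.single i (int k)) \<subseteq> S"
    "Poly_Mapping.keys (Poly_Mapping.single j (int k)) \<subseteq> S"
    using assms by simp_all
  ultimately show "Poly_Mapping.keys e \<subseteq> S" by (simp only: keys_add_subset)
qed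

lemmas laurent_in_intros = laurent_in_mult laurent_in_1 laurent_in_add laurent_in_diff laurent_in_power
  laurent_in_var laurent_in_var_inv laurent_in_inverse_one_minus_var laurent_in_inverse_one_minus_var_mult

text \<open>The constant term pairs an exponent a of f with the exponent -a of g. Both involve the
  same variables, which then lie in S and in T, so a = 0.\<close>

lemma CT_mult_disjoint:
  fixes f g :: "'a::comm_ring_1 laurent"
  assumes f: "laurent_in S f" and g: "laurent_in T g" and "S \<inter> T = {}"
  shows "CT (f * g) = CT f * CT g"
proof -
  have "coeff_laurent (f * g) 0 = (\<Sum>a\<in>{0}. coeff_laurent f a * coeff_laurent g (0 - a))"
  proof (rule coeff_times_eq, simp, clarify)
    fix a assume "coeff_laurent f a \<noteq> 0" "coeff_laurent g (0 - a) \<noteq> 0"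
    then have "Poly_Mapping.keys a \<subseteq> S" "Poly_Mapping.keys (0 - a) \<subseteq> T"
      using f g unfolding laurent_in_def by blast+
    moreover have "Poly_Mapping.keys (0 - a) = Poly_Mapping.keys a" by simp
    ultimately have "Poly_Mapping.keys a = {}" using \<open>S \<inter> T = {}\<close> by blast
    then show "a = 0" by simp
  qed
  then show ?thesis by (simp add: CT_def)
qed

text \<open>The second conjunct carries the induction, and later permits one more disjoint factor to
  be separated from the product.\<close>

lemma CT_prod_disjoint:
  fixes f :: "'b \<Rightarrow> 'a::comm_ring_1 laurent"
  assumes "finite I" "\<And>i. i \<in> I \<Longrightarrow> laurent_in (S i) (f i)"
    "\<And>i j. i \<in> I \<Longrightarrow> j \<in> I \<Longrightarrow> i \<noteq> j \<Longrightarrow> S i \<inter> S j = {}"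
  shows "CT (\<Prod>i\<in>I. f i) = (\<Prod>i\<in>I. CT (f i)) \<and> laurent_in (\<Union>i\<in>I. S i) (\<Prod>i\<in>I. f i)"
  using assms
proof (induction I rule: finite_induct)
  case (insert i I)
  then have IH: "CT (\<Prod>i\<in>I. f i) = (\<Prod>i\<in>I. CT (f i))" "laurent_in (\<Union>i\<in>I. S i) (\<Prod>i\<in>I. f i)"
    by auto
  have mono: "laurent_in U g \<Longrightarrow> U \<subseteq> V \<Longrightarrow> laurent_in V g" for U V and g :: "'a laurent"
    by (auto simp: laurent_in_def)
  have "CT (f i * (\<Prod>i\<in>I. f i)) = CT (f i) * CT (\<Prod>i\<in>I. f i)"
  proof (rule CT_mult_disjoint[OF _ IH(2)])
    show "laurent_in (S i) (f i)" using insert by auto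
    show "S i \<inter> (\<Union>i\<in>I. S i) = {}" using insert.prems(2)[of i] insert.hyps by auto
  qed
  moreover have "laurent_in (\<Union>i\<in>insert i I. S i) (f i * (\<Prod>i\<in>I. f i))"
    using insert.prems(1)[of i] IH(2) by (intro laurent_in_mult) (auto elim: mono)
  ultimately show ?case using insert.hyps IH(1) by simp
qed (auto intro: laurent_in_1)

section \<open>Constant terms against the kernel of one pair\<close>

lemma var_power_eq_monom: "var i ^ n = (monom_laurent 1 (Poly_Mapping.single i (int n)) :: 'a::comm_ring_1 laurent)"
  by (induction n) (simp_all add: one_laurent_def var_def monom_times_monom flip: single_add)

lemma var_inv_power_eq_monom: "var_inv i ^ n = (monom_laurent 1 (Poly_Mapping.single i (- int n)) :: 'a::comm_ring_1 laurent)"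
  by (induction n) (simp_all add: one_laurent_def laurent_inverse_var monom_times_monom flip: single_add)

text \<open>The product is the sum of x_i^(c+k) x_j^k over natural numbers c and k, so k = q and c =
  p - q are forced.\<close>

lemma coeff_geometric_product:
  assumes "i \<noteq> j"
  shows "coeff_laurent (inverse (1 - var i) * inverse (1 - var i * var j) :: 'a::comm_ring_1 laurent)
      (Poly_Mapping.single i p + Poly_Mapping.single j q) = (if 0 \<le> q \<and> q \<le> p then 1 else 0)"
proof -
  let ?e = "Poly_Mapping.single i p + Poly_Mapping.single j q"
  let ?f = "coeff_laurent (inverse (1 - var i) :: 'a laurent)"
    and ?g = "coeff_laurent (inverse (1 - var i * var j) :: 'a laurent)"
  let ?a = "Poly_Mapping.single i (p - q)"
  have e: "?e - ?a = Poly_Mapping.single i q + Poly_Mapping.single j q"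
    by (simp add: single_diff)
  have eqD: "q = k \<and> p - c = k" if "?e - Poly_Mapping.single i c = Poly_Mapping.single i k + Poly_Mapping.single j k" for c k
  proof -
    have "Poly_Mapping.lookup (?e - Poly_Mapping.single i c) l =
        Poly_Mapping.lookup (Poly_Mapping.single i k + Poly_Mapping.single j k) l" for l using that by simp
    from this[of i] this[of j] show ?thesis using assms
      by (simp add: lookup_minus lookup_add lookup_single when_def)
  qed
  have "coeff_laurent (inverse (1 - var i) * inverse (1 - var i * var j) :: 'a laurent) ?e =
      (\<Sum>a\<in>{?a}. ?f a * ?g (?e - a))"
  proof (rule coeff_times_eq, simp, clarify)
    fix a assume "?f a \<noteq> 0" "?g (?e - a) \<noteq> 0"
    then obtain c k :: nat where a: "a = Poly_Mapping.single i (int c)"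
      and k: "?e - a = Poly_Mapping.single i (int k) + Poly_Mapping.single j (int k)"
      unfolding coeff_inverse_one_minus_var coeff_inverse_one_minus_var_mult by (auto split: if_splits)
    from eqD[OF k[unfolded a]] have "int c = p - q" by linarith
    then show "a = ?a" using a by simp
  qed
  moreover have "?f ?a = (if q \<le> p then 1 else 0)"
  proof -
    have "(\<exists>k::nat. ?a = Poly_Mapping.single i (int k)) \<longleftrightarrow> q \<le> p"
    proof
      assume "\<exists>k::nat. ?a = Poly_Mapping.single i (int k)"
      then obtain k :: nat where "?a = Poly_Mapping.single i (int k)" ..
      then have "Poly_Mapping.lookup ?a i = int k" by simp
      then show "q \<le> p" by simp
    next
      assume "q \<le> p"
      then show "\<exists>k::nat. ?a = Poly_Mapping.single i (int k)" by (intro exI[of _ "nat (p - q)"]) simp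
    qed
    then show ?thesis by (simp add: coeff_inverse_one_minus_var)
  qed
  moreover have "?g (?e - ?a) = (if 0 \<le> q then 1 else 0)"
  proof -
    have "(\<exists>k::nat. ?e - ?a = Poly_Mapping.single i (int k) + Poly_Mapping.single j (int k)) \<longleftrightarrow> 0 \<le> q"
    proof
      assume "\<exists>k::nat. ?e - ?a = Poly_Mapping.single i (int k) + Poly_Mapping.single j (int k)"
      then show "0 \<le> q" using eqD by (metis of_nat_0_le_iff)
    next
      assume "0 \<le> q"
      then show "\<exists>k::nat. ?e - ?a = Poly_Mapping.single i (int k) + Poly_Mapping.single j (int k)"
        by (intro exI[of _ "nat q"]) (simp add: e)
    qed
    then show ?thesis by (simp only: coeff_inverse_one_minus_var_mult)
  qed
  ultimately show ?thesis by simp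
qed

definition pair_kernel :: "nat \<Rightarrow> nat \<Rightarrow> 'a::comm_ring_1 laurent" where
  "pair_kernel i j = inverse (1 - var i) * inverse (1 - var j) * pair_factor i j"

text \<open>Partial fractions: 1/(1-x) - 1/(1-y) = (x - y)/((1-x)(1-y)). Each product in the bracket
  has coefficients 0 and 1 only, decided by comparing two exponents.\<close>

lemma pair_kernel_eq:
  "pair_kernel i j = (var_inv i - var_inv j) *
     (inverse (1 - var i) * inverse (1 - var i * var j) - inverse (1 - var j) * inverse (1 - var j * var i) :: 'a::comm_ring_1 laurent)"
proof -
  define a b c where "a = (inverse (1 - var i) :: 'a laurent)" and "b = (inverse (1 - var j) :: 'a laurent)"
    and "c = (inverse (1 - var i * var j) :: 'a laurent)"
  have a: "(1 - var i) * a = 1" and b: "(1 - var j) * b = 1" and c: "(1 - var i * var j) * c = 1"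
    by (simp_all add: a_def b_def c_def)
  have "a - b = ((1 - var j) * b) * a - ((1 - var i) * a) * b" by (simp add: a b)
  also have "\<dots> = a * b * (var i - var j)" by (simp only: algebra_simps)
  finally have ab: "a - b = a * b * (var i - var j)" .
  have "pair_factor i j = pair_factor i j * ((1 - var i * var j) * c)" by (simp add: c)
  also have "\<dots> = (var_inv i - var_inv j) * (var i - var j) * c"
    unfolding var_inv_diff_mult_var_diff by (simp only: mult_ac)
  finally have "pair_kernel i j = (var_inv i - var_inv j) * (a * b * (var i - var j)) * c"
    unfolding pair_kernel_def a_def[symmetric] b_def[symmetric] by (simp only: mult_ac)
  also have "\<dots> = (var_inv i - var_inv j) * (a * c - b * c)"
    unfolding ab[symmetric] by (simp only: algebra_simps)
  finally show ?thesis by (simp add: a_def b_def c_def mult.commute[of "var j"])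
qed

lemma laurent_in_pair_kernel: "i \<in> S \<Longrightarrow> j \<in> S \<Longrightarrow> laurent_in S (pair_kernel i j :: 'a::comm_ring_1 laurent)"
  unfolding pair_kernel_def pair_factor_def by (intro laurent_in_intros)

lemma CT_var_inv_powers_mult:
  "CT (var_inv i ^ a * var_inv j ^ b * f) =
    coeff_laurent (f :: 'a::comm_ring_1 laurent) (Poly_Mapping.single i (int a) + Poly_Mapping.single j (int b))"
proof -
  have "0 - (Poly_Mapping.single i (- int a) + Poly_Mapping.single j (- int b)) =
      Poly_Mapping.single i (int a) + Poly_Mapping.single j (int b)"
    by (simp add: single_uminus)
  then show ?thesis
    by (simp only: CT_def var_inv_power_eq_monom monom_times_monom coeff_monom_times mult_1)
qed

text \<open>Multiplying out \<open>pair_kernel_eq\<close> gives [b \<le> a+1] + [a \<le> b+1] -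
  [a+1 \<le> b] - [b+1 \<le> a], where a bracket is 1 if its condition holds and 0
  otherwise.\<close>

lemma CT_var_inv_powers_pair_kernel:
  assumes "i \<noteq> j"
  shows "CT (var_inv i ^ a * var_inv j ^ b * pair_kernel i j :: 'a::comm_ring_1 laurent) =
    (if a = b then 2 else if a = Suc b \<or> b = Suc a then 1 else 0)"
proof -
  define U V where "U = (inverse (1 - var i) * inverse (1 - var i * var j) :: 'a laurent)"
    and "V = (inverse (1 - var j) * inverse (1 - var j * var i) :: 'a laurent)"
  have U: "CT (var_inv i ^ a * var_inv j ^ b * U) = (if b \<le> a then 1 else 0)" for a b
    unfolding CT_var_inv_powers_mult U_def coeff_geometric_product[OF assms] by simp
  have V: "CT (var_inv i ^ a * var_inv j ^ b * V) = (if a \<le> b then 1 else 0)" for a b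
    using coeff_geometric_product[of j i "int b" "int a", where 'a = 'a] assms
    unfolding CT_var_inv_powers_mult V_def by (simp add: add.commute)
  have "var_inv i ^ a * var_inv j ^ b * pair_kernel i j =
      (var_inv i ^ Suc a * var_inv j ^ b * U + var_inv i ^ a * var_inv j ^ Suc b * V) -
      (var_inv i ^ Suc a * var_inv j ^ b * V + var_inv i ^ a * var_inv j ^ Suc b * U)"
    unfolding pair_kernel_eq U_def[symmetric] V_def[symmetric] by (simp add: algebra_simps)
  then show ?thesis by (simp only: CT_simps U V) auto
qed

text \<open>The weight is 2 + x + 1/x, chosen because its coefficients are exactly the values found
  for \<open>pair_kernel\<close>.\<close>

lemma CT_var_powers:
  "CT (var i ^ a * var_inv i ^ b * ((1 + var i) * (1 + var_inv i)) :: 'a::comm_ring_1 laurent) =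
    (if a = b then 2 else if a = Suc b \<or> b = Suc a then 1 else 0)"
proof -
  have *: "CT (var i ^ a * var_inv i ^ b :: 'a laurent) = (if a = b then 1 else 0)" for a b
  proof -
    have "0 = Poly_Mapping.single i (int a + - int b) \<longleftrightarrow> a = b"
      by (metis add.right_inverse add_uminus_conv_diff eq_iff_diff_eq_0 lookup_single_eq lookup_zero of_nat_eq_iff single_zero)
    then show ?thesis
      unfolding var_power_eq_monom var_inv_power_eq_monom monom_times_monom CT_def single_add[symmetric]
      by simp
  qed
  have "var i ^ a * var_inv i ^ b * ((1 + var i) * (1 + var_inv i)) =
      var i ^ a * var_inv i ^ b + var i ^ a * var_inv i ^ b * (var i * var_inv i) +
      var i ^ Suc a * var_inv i ^ b + var i ^ a * var_inv i ^ Suc b"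
    by (simp only: algebra_simps power_Suc mult_1_left mult_1_right)
  also have "\<dots> = var i ^ a * var_inv i ^ b + var i ^ a * var_inv i ^ b +
      var i ^ Suc a * var_inv i ^ b + var i ^ a * (var_inv i ^ Suc b :: 'a laurent)" by simp
  finally show ?thesis by (simp only: CT_simps *) auto
qed

text \<open>By linearity it is enough to compare monomials; no compatibility with products is
  required of the two functionals.\<close>

lemma CT_subst_poly_mult_eqI:
  assumes "\<And>m. CT (monom_eval y m * K) = CT (monom_eval y' m * K')"
  shows "CT (subst_poly P y * K) = CT (subst_poly P y' * K')"
  by (simp add: subst_poly_eq_sum[OF _ subset_refl] sum_distrib_right CT_sum mult.assoc assms)

lemma prod_double_interval:
  fixes k :: nat
  shows "(\<Prod>i=1..2 * k + 1. f i) = (\<Prod>i=1..k. f i * f (k + i)) * (f (2 * k + 1) :: 'a::comm_monoid_mult)"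
proof -
  have "(\<Prod>i=1..2 * k. f i) = (\<Prod>i=1..k. f i) * (\<Prod>i=k + 1..k + k. f i)"
    by (subst prod.union_disjoint[symmetric]) (auto intro!: prod.cong)
  also have "(\<Prod>i=k + 1..k + k. f i) = (\<Prod>i=1..k. f (k + i))"
    using prod.shift_bounds_cl_nat_ivl[of f 1 k k] by (simp add: add.commute)
  finally show ?thesis by (simp add: prod.distrib)
qed

text \<open>The index \<open>2k + 1\<close> carries the unpaired variable of the odd case; \<open>s = q = 1\<close> gives the even case.\<close>

lemma CT_pair_specialization:
  fixes H :: "(nat \<Rightarrow>\<^sub>0 nat) \<Rightarrow>\<^sub>0 'a::comm_ring_1" and s q :: "'a laurent"
  assumes sq: "laurent_in {2 * k + 1} s" "laurent_in {2 * k + 1} q" "\<And>e. CT (s ^ e * q) = 1"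
    and y: "\<And>i. i \<in> {1..2 * k} \<Longrightarrow> y i = var_inv i" "y (2 * k + 1) = s" "\<And>i. i \<notin> {1..2 * k + 1} \<Longrightarrow> y i = 1"
    and z: "\<And>i. i \<in> {1..k} \<Longrightarrow> z i = var i" "\<And>i. i \<in> {1..k} \<Longrightarrow> z (k + i) = var_inv i"
      "\<And>i. i \<notin> {1..2 * k} \<Longrightarrow> z i = 1"
  shows "CT (subst_poly H y * ((\<Prod>i=1..k. pair_kernel i (k + i)) * q)) =
    CT (subst_poly H z * (\<Prod>i=1..k. (1 + var i) * (1 + var_inv i)))"
proof (rule CT_subst_poly_mult_eqI)
  fix m :: "nat \<Rightarrow>\<^sub>0 nat"
  let ?m = "Poly_Mapping.lookup m"
  let ?f = "\<lambda>i. var_inv i ^ ?m i * var_inv (k + i) ^ ?m (k + i) * pair_kernel i (k + i) :: 'a laurent"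
  let ?g = "\<lambda>i. var i ^ ?m i * var_inv i ^ ?m (k + i) * ((1 + var i) * (1 + var_inv i)) :: 'a laurent"
  let ?r = "s ^ ?m (2 * k + 1) * q"
  \<comment> \<open>The value 1 of y outside 1..2k+1 absorbs all further variables that the monomial
    may contain.\<close>
  have "monom_eval y m = (\<Prod>i=1..2 * k + 1. y i ^ ?m i)" by (rule monom_eval_eq_prod) (use y in auto)
  also have "\<dots> = (\<Prod>i=1..k. y i ^ ?m i * y (k + i) ^ ?m (k + i)) * y (2 * k + 1) ^ ?m (2 * k + 1)"
    by (rule prod_double_interval)
  also have "\<dots> = (\<Prod>i=1..k. var_inv i ^ ?m i * var_inv (k + i) ^ ?m (k + i)) * s ^ ?m (2 * k + 1)"
    using y by (intro arg_cong2[where f = "(*)"] prod.cong) auto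
  finally have L: "monom_eval y m * ((\<Prod>i=1..k. pair_kernel i (k + i)) * q) = (\<Prod>i=1..k. ?f i) * ?r"
    by (simp add: prod.distrib mult_ac)
  have "monom_eval z m = (\<Prod>i=1..2 * k + 1. z i ^ ?m i)" by (rule monom_eval_eq_prod) (use z in auto)
  also have "\<dots> = (\<Prod>i=1..k. z i ^ ?m i * z (k + i) ^ ?m (k + i)) * z (2 * k + 1) ^ ?m (2 * k + 1)"
    by (rule prod_double_interval)
  also have "\<dots> = (\<Prod>i=1..k. var i ^ ?m i * var_inv i ^ ?m (k + i))"
  proof -
    have "z (2 * k + 1) = 1" using z(3) by simp
    then show ?thesis using z unfolding \<open>z (2 * k + 1) = 1\<close> power_one mult_1_right
      by (intro prod.cong) auto
  qed
  finally have R: "monom_eval z m * (\<Prod>i=1..k. (1 + var i) * (1 + var_inv i)) = (\<Prod>i=1..k. ?g i)"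
    by (simp only: prod.distrib)
  have f: "CT (\<Prod>i=1..k. ?f i) = (\<Prod>i=1..k. CT (?f i)) \<and> laurent_in (\<Union>i\<in>{1..k}. {i, k + i}) (\<Prod>i=1..k. ?f i)"
    by (rule CT_prod_disjoint) (auto intro!: laurent_in_intros laurent_in_pair_kernel)
  have g: "CT (\<Prod>i=1..k. ?g i) = (\<Prod>i=1..k. CT (?g i)) \<and> laurent_in (\<Union>i\<in>{1..k}. {i}) (\<Prod>i=1..k. ?g i)"
    by (rule CT_prod_disjoint) (auto intro!: laurent_in_intros)
  \<comment> \<open>\<open>?r\<close> involves only the variable 2k+1, which lies outside every
    block formed by i and k+i.\<close>
  have "CT ((\<Prod>i=1..k. ?f i) * ?r) = CT (\<Prod>i=1..k. ?f i) * CT ?r"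
    by (rule CT_mult_disjoint[OF conjunct2[OF f]]) (auto intro!: laurent_in_intros sq)
  also have "\<dots> = (\<Prod>i=1..k. CT (?f i))" using f sq(3) by simp
  also have "\<dots> = (\<Prod>i=1..k. CT (?g i))"
  proof (rule prod.cong[OF refl])
    fix i assume "i \<in> {1..k}"
    then have "i \<noteq> k + i" by simp
    then show "CT (?f i) = CT (?g i)" unfolding CT_var_powers by (rule CT_var_inv_powers_pair_kernel)
  qed
  also have "\<dots> = CT (\<Prod>i=1..k. ?g i)" using g by simp
  finally show "CT (monom_eval y m * ((\<Prod>i=1..k. pair_kernel i (k + i)) * q)) =
      CT (monom_eval z m * (\<Prod>i=1..k. (1 + var i) * (1 + var_inv i)))"
    unfolding L R .
qed

section \<open>Splitting off pairs of variables\<close>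

text \<open>Index i is paired with k+i because \<open>paired_point\<close> holds x_i and its inverse
  at these two places.\<close>

definition pair_indices :: "nat \<Rightarrow> nat \<Rightarrow> nat set" where
  "pair_indices k r = {1..r} \<union> {k + 1..k + r}"

text \<open>This is the Vandermonde product of the numbers x_i + 1/x_i; the discriminant in the
  usual sense is its square.\<close>

definition discriminant :: "nat \<Rightarrow> 'a::comm_ring_1 laurent" where
  "discriminant k = (\<Prod>j<k. \<Prod>i<j. var (Suc j) + var_inv (Suc j) - (var (Suc i) + var_inv (Suc i)))"

lemma finite_pair_indices [simp]: "finite (pair_indices k r)"
  by (simp add: pair_indices_def)

lemma pair_indices_Suc: "pair_indices k (Suc r) = insert (Suc r) (insert (k + Suc r) (pair_indices k r))"
  by (auto simp: pair_indices_def)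

lemma pair_indices_self: "pair_indices k k = {1..2 * k}"
  by (auto simp: pair_indices_def)

lemma notin_pair_indices: "r < k \<Longrightarrow> Suc r \<notin> pair_indices k r" "r < k \<Longrightarrow> k + Suc r \<notin> pair_indices k r"
  by (auto simp: pair_indices_def)

lemma card_pair_indices: "r \<le> k \<Longrightarrow> card (pair_indices k r) = 2 * r"
  unfolding pair_indices_def by (subst card_Un_disjoint) auto

lemma prod_pair_indices:
  assumes "r \<le> k"
  shows "(\<Prod>l\<in>pair_indices k r. f l) = (\<Prod>i<r. f (Suc i) * f (k + Suc i) :: 'a::comm_monoid_mult)"
  using assms
proof (induction r)
  case (Suc r)
  then show ?case using notin_pair_indices[of r k] by (simp add: pair_indices_Suc mult_ac)
qed (simp add: pair_indices_def)

text \<open>For r = 0 the truncated 2r - 1 is 0, and \<open>double_fact 0\<close> = 1 is the right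
  value for (-1)!!.\<close>

lemma double_fact_odd: "double_fact (2 * Suc r - 1) = (2 * r + 1) * double_fact (2 * r - 1)"
  by (cases r) auto

text \<open>The even factors of (2k)! contribute 2^k k!, the odd ones the double factorial.\<close>

lemma fact_double: "fact (2 * k) = 2 ^ k * fact k * double_fact (2 * k - 1)"
proof (induction k)
  case (Suc k)
  have "fact (2 * Suc k) = (2 * k + 2) * ((2 * k + 1) * fact (2 * k :: nat))"
    by (simp add: algebra_simps)
  then show ?case unfolding double_fact_odd Suc.IH by (simp add: algebra_simps)
qed simp

lemma rename_vars_transpose_prod:
  fixes f :: "nat \<Rightarrow> 'a::comm_ring_1 laurent"
  assumes "i \<in> L" "j \<in> L" "\<And>l. l \<in> L \<Longrightarrow> rename_vars (Transposition.transpose i j) (f l) = f (Transposition.transpose i j l)"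
  shows "rename_vars (Transposition.transpose i j) (\<Prod>l\<in>L. f l) = (\<Prod>l\<in>L. f l)"
proof -
  have "rename_vars (Transposition.transpose i j) (\<Prod>l\<in>L. f l) = (\<Prod>l\<in>L. f (Transposition.transpose i j l))"
    using assms by (simp add: rename_vars_prod)
  also have "\<dots> = (\<Prod>l\<in>L. f l)"
    using assms(1,2) prod.permute[OF permutes_swap_id[OF assms(1,2)], of f] by (simp add: o_def)
  finally show ?thesis .
qed

text \<open>The cross factor of \<open>peel_two\<close> when the pair r+1, k+r+1 is split off. The
  ring is left open because x will be the polynomial indeterminates, the inverse variables and the
  specialized point.\<close>

definition pair_vandermonde :: "(nat \<Rightarrow> 'b::comm_ring_1) \<Rightarrow> nat \<Rightarrow> nat \<Rightarrow> 'b" where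
  "pair_vandermonde x k r = (\<Prod>l\<in>pair_indices k r. (x (Suc r) - x l) * (x (k + Suc r) - x l))"

text \<open>Induction on r, splitting off the last pair: with 2r+2 variables left there are 2r+1
  equal terms. R is arbitrary since the split-off kernel and cross factor pass into it, both being
  symmetric in the remaining variables.\<close>

lemma CT_littlewood_kernel_pairs:
  fixes R :: "'a::{idom,ring_char_0} laurent"
  assumes "r \<le> k"
    and "\<And>i j. i \<in> pair_indices k r \<Longrightarrow> j \<in> pair_indices k r \<Longrightarrow> rename_vars (Transposition.transpose i j) R = R"
  shows "CT (littlewood_kernel (pair_indices k r) * R) = of_nat (double_fact (2 * r - 1)) *
    CT ((\<Prod>i=1..r. pair_kernel i (k + i)) * (\<Prod>i<r. pair_vandermonde var_inv k i) * R)"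
  using assms
proof (induction r arbitrary: R)
  case 0
  then show ?case by (simp add: pair_indices_def)
next
  case (Suc r)
  let ?L = "pair_indices k (Suc r)" and ?a = "Suc r" and ?b = "k + Suc r"
  let ?Y = "pair_vandermonde var_inv k r :: 'a laurent"
  have "r < k" using Suc.prems by simp
  then have L: "?L - {?a, ?b} = pair_indices k r" "?a \<noteq> ?b" "?a \<in> ?L" "?b \<in> ?L" and card: "card ?L = 2 * r + 2"
    using notin_pair_indices[of r k] card_pair_indices[of "Suc r" k] by (auto simp: pair_indices_Suc)
  have card_minus: "2 * r + 2 - 1 = 2 * r + 1" by simp
  have "CT (littlewood_kernel ?L * R) = of_nat (card ?L - 1) * CT (peel_two ?L ?a ?b * R)"
    by (rule CT_littlewood_kernel_peel_two[OF finite_pair_indices _ L(3,4,2) Suc.prems(2)]) (simp add: card)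
  also have "peel_two ?L ?a ?b * R = littlewood_kernel (pair_indices k r) * (pair_kernel ?a ?b * ?Y * R)"
    unfolding peel_two_def L(1) pair_kernel_def pair_vandermonde_def by (simp only: mult_ac)
  also have "CT \<dots> = of_nat (double_fact (2 * r - 1)) * CT ((\<Prod>i=1..r. pair_kernel i (k + i)) *
      (\<Prod>i<r. pair_vandermonde var_inv k i) * (pair_kernel ?a ?b * ?Y * R))"
  proof (rule Suc.IH)
    fix i j assume ij: "i \<in> pair_indices k r" "j \<in> pair_indices k r"
    let ?\<tau> = "Transposition.transpose i j"
    have fixed: "?\<tau> ?a = ?a" "?\<tau> ?b = ?b"
      using ij notin_pair_indices[OF \<open>r < k\<close>] by (metis transpose_apply_other)+
    have "rename_vars ?\<tau> ?Y = ?Y" unfolding pair_vandermonde_def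
      by (rule rename_vars_transpose_prod[OF ij]) (simp add: rename_vars_mult rename_vars_diff fixed del: add_Suc_right)
    moreover have "rename_vars ?\<tau> (pair_kernel ?a ?b) = (pair_kernel ?a ?b :: 'a laurent)"
      by (simp add: pair_kernel_def rename_vars_mult fixed del: add_Suc_right)
    moreover have "rename_vars ?\<tau> R = R"
      using ij by (intro Suc.prems) (auto simp: pair_indices_Suc)
    ultimately show "rename_vars ?\<tau> (pair_kernel ?a ?b * ?Y * R) = pair_kernel ?a ?b * ?Y * R"
      by (simp only: rename_vars_mult bij_transpose)
  qed (use \<open>r < k\<close> in simp)
  also have "(\<Prod>i=1..r. pair_kernel i (k + i)) * (\<Prod>i<r. pair_vandermonde var_inv k i) * (pair_kernel ?a ?b * ?Y * R) =
      (\<Prod>i=1..Suc r. pair_kernel i (k + i)) * (\<Prod>i<Suc r. pair_vandermonde var_inv k i) * R"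
    by (simp add: mult_ac)
  finally show ?case
    unfolding double_fact_odd card card_minus of_nat_mult mult.assoc .
qed

text \<open>If a a' = b b' = 1, then (a - b)(a' - b) = b (b + b' - a - a'), and the same holds with
  b and b' exchanged. In the product of the two, b b' = 1 disappears and a square remains.\<close>

lemma pair_vandermonde_paired:
  fixes x :: "nat \<Rightarrow> 'a::comm_ring_1 laurent"
  assumes "r < k" and x: "\<And>i. i \<in> {1..k} \<Longrightarrow> x i = var i" "\<And>i. i \<in> {1..k} \<Longrightarrow> x (k + i) = var_inv i"
  shows "pair_vandermonde x k r =
    (\<Prod>i<r. var (Suc r) + var_inv (Suc r) - (var (Suc i) + var_inv (Suc i)))\<^sup>2"
proof -
  have "(x (Suc r) - x (Suc i)) * (x (k + Suc r) - x (Suc i)) *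
      ((x (Suc r) - x (k + Suc i)) * (x (k + Suc r) - x (k + Suc i))) =
      (var (Suc r) + var_inv (Suc r) - (var (Suc i) + var_inv (Suc i)))\<^sup>2" if "i < r" for i
  proof -
    define a a' b b' where "a = (var (Suc r) :: 'a laurent)" and "a' = (var_inv (Suc r) :: 'a laurent)"
      and "b = (var (Suc i) :: 'a laurent)" and "b' = (var_inv (Suc i) :: 'a laurent)"
    have inv: "a * a' = 1" "b * b' = 1" by (simp_all add: a_def a'_def b_def b'_def)
    have "(a - b) * (a' - b) = a * a' - b * (a + a') + b * b" by (simp add: algebra_simps)
    also have "\<dots> = b * b' - b * (a + a') + b * b" by (simp only: inv)
    also have "\<dots> = b * (b + b' - (a + a'))" by (simp add: algebra_simps)
    finally have 1: "(a - b) * (a' - b) = b * (b + b' - (a + a'))" .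
    have "(a - b') * (a' - b') = a * a' - b' * (a + a') + b' * b'" by (simp add: algebra_simps)
    also have "\<dots> = b * b' - b' * (a + a') + b' * b'" by (simp only: inv)
    also have "\<dots> = b' * (b + b' - (a + a'))" by (simp add: algebra_simps)
    finally have 2: "(a - b') * (a' - b') = b' * (b + b' - (a + a'))" .
    have "(a - b) * (a' - b) * ((a - b') * (a' - b')) = (b * b') * (b + b' - (a + a'))\<^sup>2"
      unfolding 1 2 power2_eq_square by (simp only: mult_ac)
    also have "\<dots> = (a + a' - (b + b'))\<^sup>2" unfolding inv mult_1_left by (rule power2_commute)
    finally show ?thesis using that \<open>r < k\<close> by (simp add: x a_def a'_def b_def b'_def del: add_Suc_right)
  qed
  then show ?thesis unfolding pair_vandermonde_def prod_pair_indices[OF less_imp_le[OF \<open>r < k\<close>]] prod_power_distrib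
    by (intro prod.cong) auto
qed

lemma CT_littlewood_kernel_specialization:
  fixes G :: "(nat \<Rightarrow>\<^sub>0 nat) \<Rightarrow>\<^sub>0 'a::{idom,ring_char_0}" and s q :: "'a laurent"
  assumes sq: "laurent_in {2 * k + 1} s" "laurent_in {2 * k + 1} q" "\<And>e. CT (s ^ e * q) = 1"
    and y: "\<And>i. i \<in> {1..2 * k} \<Longrightarrow> y i = var_inv i" "y (2 * k + 1) = s" "\<And>i. i \<notin> {1..2 * k + 1} \<Longrightarrow> y i = 1"
    and z: "\<And>i. i \<in> {1..k} \<Longrightarrow> z i = var i" "\<And>i. i \<in> {1..k} \<Longrightarrow> z (k + i) = var_inv i"
      "\<And>i. i \<notin> {1..2 * k} \<Longrightarrow> z i = 1"
    and sym: "\<And>i j. i \<in> {1..2 * k} \<Longrightarrow> j \<in> {1..2 * k} \<Longrightarrow>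
      rename_vars (Transposition.transpose i j) (subst_poly G y * q) = subst_poly G y * q"
  shows "CT (littlewood_kernel {1..2 * k} * (subst_poly G y * q)) = of_nat (double_fact (2 * k - 1)) *
    CT (subst_poly G z * (\<Prod>i=1..k. (1 + var i) * (1 + var_inv i)) * (discriminant k)\<^sup>2)"
proof -
  \<comment> \<open>The cross factors are assembled as a polynomial, to be substituted together with
    G: the specialization is not multiplicative and must be applied to the whole of V * G at
    once.\<close>
  define V :: "(nat \<Rightarrow>\<^sub>0 nat) \<Rightarrow>\<^sub>0 'a" where "V = (\<Prod>i<k. pair_vandermonde poly_var k i)"
  have V: "subst_poly V x = (\<Prod>i<k. pair_vandermonde x k i)" for x
    by (simp add: V_def pair_vandermonde_def subst_hom.hom_prod subst_hom.hom_mult subst_hom.hom_minus)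
  have "pair_vandermonde y k r = pair_vandermonde var_inv k r" if "r < k" for r
    unfolding pair_vandermonde_def using that
    by (intro prod.cong refl arg_cong2[where f = "(*)"] arg_cong2[where f = "(-)"] y) (auto simp: pair_indices_def)
  then have Vy: "subst_poly V y = (\<Prod>i<k. pair_vandermonde var_inv k i)" by (simp add: V)
  have Vz: "subst_poly V z = (discriminant k)\<^sup>2"
    unfolding V discriminant_def
  proof (subst prod_power_distrib, rule prod.cong[OF refl])
    fix r assume "r \<in> {..<k}"
    then have "r < k" by simp
    then show "pair_vandermonde z k r = (\<Prod>i<r. var (Suc r) + var_inv (Suc r) - (var (Suc i) + var_inv (Suc i)))\<^sup>2"
      by (rule pair_vandermonde_paired) (fact z)+
  qed
  have "CT (littlewood_kernel {1..2 * k} * (subst_poly G y * q)) = of_nat (double_fact (2 * k - 1)) *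
     CT ((\<Prod>i=1..k. pair_kernel i (k + i)) * subst_poly V y * (subst_poly G y * q))"
    unfolding Vy using CT_littlewood_kernel_pairs[of k k "subst_poly G y * q"] sym
    by (simp add: pair_indices_self)
  also have "(\<Prod>i=1..k. pair_kernel i (k + i)) * subst_poly V y * (subst_poly G y * q) =
      subst_poly (V * G) y * ((\<Prod>i=1..k. pair_kernel i (k + i)) * q)"
    by (simp add: subst_poly_mult mult_ac)
  also have "CT \<dots> = CT (subst_poly (V * G) z * (\<Prod>i=1..k. (1 + var i) * (1 + var_inv i)))"
    by (rule CT_pair_specialization[OF sq y z])
  also have "subst_poly (V * G) z * (\<Prod>i=1..k. (1 + var i) * (1 + var_inv i)) =
      subst_poly G z * (\<Prod>i=1..k. (1 + var i) * (1 + var_inv i)) * (discriminant k)\<^sup>2"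
    by (simp only: subst_poly_mult Vz mult_ac)
  finally show ?thesis .
qed

section \<open>Determinants\<close>

text \<open>The matrix is the Vandermonde matrix times the matrix of coefficients, which is upper
  triangular with unit diagonal.\<close>

lemma det_monic_poly_mat_eq:
  fixes u :: "nat \<Rightarrow> 'a::idom"
  assumes p: "\<And>j. Polynomial.degree (p j) = j" "\<And>j. Polynomial.coeff (p j) j = 1"
  shows "det (mat k k (\<lambda>(i, j). poly (p j) (u i))) = det (mat k k (\<lambda>(i, j). u i ^ j))"
proof -
  let ?V = "mat k k (\<lambda>(i, j). u i ^ j)" and ?U = "mat k k (\<lambda>(l, j). Polynomial.coeff (p j) l)"
  have "mat k k (\<lambda>(i, j). poly (p j) (u i)) = ?V * ?U"
  proof (rule eq_matI)
    fix i j assume ij: "i < dim_row (?V * ?U)" "j < dim_col (?V * ?U)"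
    have "poly (p j) (u i) = (\<Sum>l\<le>j. Polynomial.coeff (p j) l * u i ^ l)" by (simp add: poly_altdef p)
    also have "\<dots> = (\<Sum>l = 0..<k. Polynomial.coeff (p j) l * u i ^ l)"
      using ij by (intro sum.mono_neutral_left) (auto intro: coeff_eq_0 simp: p)
    finally show "mat k k (\<lambda>(i, j). poly (p j) (u i)) $$ (i, j) = (?V * ?U) $$ (i, j)"
      using ij by (simp add: scalar_prod_def mult.commute)
  qed auto
  moreover have "det ?U = 1"
  proof -
    have "upper_triangular ?U" by (auto simp: upper_triangular_def p intro!: coeff_eq_0)
    then have "det ?U = prod_list (diag_mat ?U)" by (rule det_upper_triangular[where n = k]) auto
    also have "\<dots> = 1" by (simp add: diag_mat_def p prod.list_conv_set_nth)
    finally show ?thesis .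
  qed
  ultimately show ?thesis by (simp add: det_mult[where n = k])
qed

text \<open>The determinant does not depend on the monic polynomials; for the Newton basis
  \<open>\<Prod>i<j. X - u i\<close> the matrix is triangular.\<close>

lemma det_monic_poly_mat:
  fixes u :: "nat \<Rightarrow> 'a::idom"
  assumes p: "\<And>j. Polynomial.degree (p j) = j" "\<And>j. Polynomial.coeff (p j) j = 1"
  shows "det (mat k k (\<lambda>(i, j). poly (p j) (u i))) = (\<Prod>j<k. \<Prod>i<j. u j - u i)"
proof -
  define q where "q j = (\<Prod>i<j. [:- u i, 1:])" for j
  have "Polynomial.degree (q j) = j \<and> lead_coeff (q j) = 1" for j
  proof (induction j)
    case (Suc j)
    have q_Suc: "q (Suc j) = q j * [:- u j, 1:]" by (simp only: q_def prod.lessThan_Suc)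
    have IH: "Polynomial.degree (q j) = j" "lead_coeff (q j) = 1" using Suc by blast+
    then have "q j \<noteq> 0" by auto
    then have "Polynomial.degree (q (Suc j)) = Suc j"
      unfolding q_Suc by (subst degree_mult_eq) (auto simp: IH(1))
    moreover have "lead_coeff (q (Suc j)) = 1"
      unfolding q_Suc lead_coeff_mult IH(2) by simp
    ultimately show ?case by blast
  qed (simp add: q_def)
  then have q: "Polynomial.degree (q j) = j" "Polynomial.coeff (q j) j = 1" for j by metis+
  let ?N = "mat k k (\<lambda>(i, j). poly (q j) (u i))"
  have "poly (q j) (u i) = (\<Prod>l<j. u i - u l)" for i j by (simp add: q_def poly_prod)
  then have N: "?N = mat k k (\<lambda>(i, j). \<Prod>l<j. u i - u l)" by simp
  have "det ?N = prod_list (diag_mat ?N)"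
    by (rule det_lower_triangular[where n = k]) (auto simp: N)
  also have "diag_mat ?N = map (\<lambda>j. \<Prod>i<j. u j - u i) [0..<k]" by (simp add: diag_mat_def N cong: map_cong)
  also have "prod_list \<dots> = (\<Prod>j<k. \<Prod>i<j. u j - u i)"
    by (simp add: prod.list_conv_set_nth atLeast0LessThan)
  finally show ?thesis using det_monic_poly_mat_eq[OF p] det_monic_poly_mat_eq[OF q] by metis
qed

lemma det_scale_rows:
  "det (mat k k (\<lambda>(i, j). c i * a i j)) = (\<Prod>i<k. c i) * det (mat k k (\<lambda>(i, j). a i j :: 'a::comm_ring_1))"
proof -
  have "(\<Prod>i = 0..<k. mat k k (\<lambda>(i, j). c i * a i j) $$ (i, p i)) =
      (\<Prod>i<k. c i) * (\<Prod>i = 0..<k. mat k k (\<lambda>(i, j). a i j) $$ (i, p i))" if "p permutes {0..<k}" for p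
  proof -
    have "p i < k" if "i < k" for i using permutes_in_image[OF \<open>p permutes {0..<k}\<close>, of i] that by simp
    then show ?thesis by (simp add: prod.distrib atLeast0LessThan)
  qed
  then show ?thesis by (simp add: det_def sum_distrib_left mult_ac)
qed

text \<open>For \<open>c = 0\<close> and \<open>c = 1\<close> these are rescaled Chebyshev polynomials of the second and third kind.\<close>

fun chebyshev :: "'a::comm_ring_1 \<Rightarrow> nat \<Rightarrow> 'a poly" where
  "chebyshev c 0 = 1"
| "chebyshev c (Suc 0) = [:- c, 1:]"
| "chebyshev c (Suc (Suc n)) = [:0, 1:] * chebyshev c (Suc n) - chebyshev c n"

lemma chebyshev_monic:
  "Polynomial.degree (chebyshev c n) \<le> n \<and> Polynomial.coeff (chebyshev c n) n = 1"
proof (induction c n rule: chebyshev.induct)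
  case (3 c n)
  have "Polynomial.degree ([:0, 1:] * chebyshev c (Suc n)) \<le> Suc (Suc n)"
    using 3 by (intro order_trans[OF degree_mult_le]) simp
  then have "Polynomial.degree (chebyshev c (Suc (Suc n))) \<le> Suc (Suc n)"
    using 3 by (auto intro!: degree_diff_le)
  moreover have "Polynomial.coeff (chebyshev c n) (Suc (Suc n)) = 0" using 3 by (intro coeff_eq_0) simp
  ultimately show ?case using 3 by simp
qed auto

lemma degree_chebyshev: "Polynomial.degree (chebyshev c n) = n"
  using chebyshev_monic[of c n] le_degree[of "chebyshev c n" n] by (simp add: order_antisym)

text \<open>Both sides satisfy u_(n+2) = (z + w) u_(n+1) - u_n. They agree trivially at n = 0, and
  the assumption on a, b, c is precisely agreement at n = 1.\<close>

lemma poly_chebyshev: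
  assumes zw: "z * w = (1 :: 'a::comm_ring_1)" and ab: "a * w + b * z = c * (a + b)"
  shows "(a + b) * poly (chebyshev c n) (z + w) = a * z ^ n + b * w ^ n"
  using ab
proof (induction c n rule: chebyshev.induct)
  case (2 c)
  have "(a + b) * poly (chebyshev c (Suc 0)) (z + w) = a * z + b * w + (a * w + b * z) - c * (a + b)"
    by (simp add: algebra_simps)
  then show ?case using 2 by simp
next
  case (3 c n)
  have "(a + b) * poly (chebyshev c (Suc (Suc n))) (z + w) =
      (z + w) * ((a + b) * poly (chebyshev c (Suc n)) (z + w)) - (a + b) * poly (chebyshev c n) (z + w)"
    by (simp add: algebra_simps)
  also have "\<dots> = (z + w) * (a * z ^ Suc n + b * w ^ Suc n) - (a * z ^ n + b * w ^ n)"
    using 3 by simp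
  also have "\<dots> = a * z ^ Suc (Suc n) + b * w ^ Suc (Suc n) + (z * w - 1) * (a * z ^ n + b * w ^ n)"
    by (simp add: algebra_simps)
  finally show ?case by (simp add: zw)
qed simp

lemma var_powi:
  "var i powi int n = var i ^ n" "var i powi - int n = var_inv i ^ n"
  "var i powi (int (n + 1) - 1) = var i ^ n" "var i powi (1 - int (n + 1)) = var_inv i ^ n"
  by (auto simp: power_int_def)

lemma det_chebyshev_mat:
  fixes c :: "'a::idom laurent"
  shows "det (mat k k (\<lambda>(i, j). poly (chebyshev c j) (var (Suc i) + var_inv (Suc i)))) = discriminant k"
  unfolding discriminant_def
  using det_monic_poly_mat[of "chebyshev c" k "\<lambda>i. var (Suc i) + var_inv (Suc i)"] chebyshev_monic degree_chebyshev
  by blast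

lemma B_det_eq: "B_det k = (\<Prod>i<k. var_inv (Suc i) - var (Suc i)) * discriminant k"
proof -
  have "var (i + 1) powi (- int (j + 1)) - var (i + 1) powi int (j + 1) =
      (var_inv (Suc i) - var (Suc i)) * poly (chebyshev 0 j) (var (Suc i) + var_inv (Suc i) :: rat laurent)" for i j
    \<comment> \<open>With a = -x and b = 1/x one has a/x + b x = 0, hence c = 0.\<close>
    using poly_chebyshev[of "var (Suc i)" "var_inv (Suc i)" "- var (Suc i)" "var_inv (Suc i)" 0 j, symmetric]
    by (simp only: var_powi) (simp add: algebra_simps)
  then show ?thesis unfolding B_det_def by (simp only: det_scale_rows det_chebyshev_mat)
qed

lemma Bbar_det_eq: "Bbar_det k = (\<Prod>i<k. 1 + var_inv (Suc i)) * discriminant k"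
proof -
  have "var (i + 1) powi (int (j + 1) - 1) + var (i + 1) powi (- int (j + 1)) =
      (1 + var_inv (Suc i)) * poly (chebyshev 1 j) (var (Suc i) + var_inv (Suc i) :: rat laurent)" for i j
    \<comment> \<open>With a = 1 and b = 1/x one has a/x + b x = a + b, hence c = 1.\<close>
    using poly_chebyshev[of "var (Suc i)" "var_inv (Suc i)" 1 "var_inv (Suc i)" 1 j, symmetric]
    by (simp only: var_powi) (simp add: algebra_simps)
  then show ?thesis unfolding Bbar_det_def by (simp only: det_scale_rows det_chebyshev_mat)
qed

section \<open>Leibniz expansion under the constant term\<close>

text \<open>Translates a permutation of matrix rows, counted from 0, into one of variables, counted
  from 1; index 0 stays fixed.\<close>

definition shift_perm :: "(nat \<Rightarrow> nat) \<Rightarrow> nat \<Rightarrow> nat" where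
  "shift_perm p i = (if i = 0 then 0 else Suc (p (i - 1)))"

lemma shift_perm_permutes:
  assumes "p permutes {0..<k}"
  shows "shift_perm p permutes {1..k}"
proof (rule bij_imp_permutes)
  show "bij_betw (shift_perm p) {1..k} {1..k}"
  proof (rule bij_betw_byWitness[where f' = "shift_perm (Hilbert_Choice.inv p)"])
    have in_image: "p i < k \<longleftrightarrow> i < k" "Hilbert_Choice.inv p i < k \<longleftrightarrow> i < k" for i
      using permutes_in_image[OF assms, of i] permutes_in_image[OF permutes_inv[OF assms], of i] by auto
    show "\<forall>a\<in>{1..k}. shift_perm (Hilbert_Choice.inv p) (shift_perm p a) = a"
      "\<forall>a\<in>{1..k}. shift_perm p (shift_perm (Hilbert_Choice.inv p) a) = a"
      using permutes_inverses[OF assms] by (auto simp: shift_perm_def)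
    have "shift_perm p i \<in> {1..k}" "shift_perm (Hilbert_Choice.inv p) i \<in> {1..k}" if "i \<in> {1..k}" for i
    proof -
      have "i \<noteq> 0" "i - 1 < k" using that by auto
      then have "p (i - 1) < k" "Hilbert_Choice.inv p (i - 1) < k" by (simp_all only: in_image)
      then show "shift_perm p i \<in> {1..k}" "shift_perm (Hilbert_Choice.inv p) i \<in> {1..k}"
        using \<open>i \<noteq> 0\<close> by (simp_all add: shift_perm_def Suc_le_eq)
    qed
    then show "shift_perm p ` {1..k} \<subseteq> {1..k}" "shift_perm (Hilbert_Choice.inv p) ` {1..k} \<subseteq> {1..k}"
      by blast+
  qed
  show "shift_perm p i = i" if "i \<notin> {1..k}" for i
    using that permutes_not_in[OF assms, of "i - 1"] by (auto simp: shift_perm_def)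
qed

text \<open>Renaming the variables along p turns the Leibniz term of p into the diagonal term, and
  permutes the rows of the other determinant. The sign from these rows cancels the sign of the term,
  so all k! terms have the same constant term.\<close>

lemma CT_mult_det_mult_det:
  fixes a b :: "nat \<Rightarrow> nat \<Rightarrow> 'a::{comm_ring_1,semiring_char_0} laurent"
  assumes S: "\<And>\<pi>. \<pi> permutes {1..k} \<Longrightarrow> rename_vars \<pi> S = S"
    and a: "\<And>\<pi> i j. bij \<pi> \<Longrightarrow> rename_vars \<pi> (a i j) = a (\<pi> i) j"
    and b: "\<And>\<pi> i j. bij \<pi> \<Longrightarrow> rename_vars \<pi> (b i j) = b (\<pi> i) j"
  shows "CT (S * det (mat k k (\<lambda>(i, j). b (Suc i) j)) * det (mat k k (\<lambda>(i, j). a (Suc i) j))) =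
    fact k * CT (S * det (mat k k (\<lambda>(i, j). b (Suc i) j)) * (\<Prod>i<k. a (Suc i) i))"
proof -
  let ?b = "mat k k (\<lambda>(i, j). b (Suc i) j)"
  let ?t = "S * det ?b * (\<Prod>i<k. a (Suc i) i)"
  have "CT (S * det ?b * (signof p * (\<Prod>i<k. a (Suc i) (p i)))) = CT ?t" if p: "p permutes {0..<k}" for p
  proof -
    let ?\<pi> = "shift_perm p"
    have bij: "bij ?\<pi>" using shift_perm_permutes[OF p] by (rule permutes_bij)
    interpret rename: comm_ring_hom "rename_vars ?\<pi> :: 'a laurent \<Rightarrow> 'a laurent"
      using bij by (rule comm_ring_hom_rename_vars)
    have lt: "p i < k" if "i < k" for i using permutes_in_image[OF p, of i] that by simp
    have "map_mat (rename_vars ?\<pi>) ?b = mat k k (\<lambda>(i, j). ?b $$ (p i, j))"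
      by (rule eq_matI) (auto simp: b[OF bij] lt shift_perm_def)
    then have ren_b: "rename_vars ?\<pi> (det ?b) = signof p * det ?b"
      unfolding rename.hom_det[symmetric] by (simp add: det_permute_rows[OF _ p])
    have ren_a: "rename_vars ?\<pi> (\<Prod>i<k. a (Suc i) (p i)) = (\<Prod>i<k. a (Suc i) i)"
    proof -
      have "rename_vars ?\<pi> (\<Prod>i<k. a (Suc i) (p i)) = (\<Prod>i<k. a (Suc (p i)) (p i))"
        by (simp add: rename.hom_prod a[OF bij] shift_perm_def)
      also have "\<dots> = (\<Prod>i<k. a (Suc i) i)"
        using prod.permute[OF p, of "\<lambda>i. a (Suc i) i"] by (simp add: o_def atLeast0LessThan)
      finally show ?thesis .
    qed
    have "rename_vars ?\<pi> (S * det ?b * (signof p * (\<Prod>i<k. a (Suc i) (p i)))) =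
        (signof p * signof p) * ?t"
      unfolding rename.hom_mult rename.hom_signof S[OF shift_perm_permutes[OF p]] ren_a ren_b
      by (simp only: mult_ac)
    also have "signof p * signof p = (1 :: 'a laurent)" by (simp add: sign_def)
    finally have "rename_vars ?\<pi> (S * det ?b * (signof p * (\<Prod>i<k. a (Suc i) (p i)))) = ?t"
      unfolding mult_1_left .
    from arg_cong[OF this, of CT] show ?thesis unfolding CT_rename_vars[OF bij] .
  qed
  moreover have "det (mat k k (\<lambda>(i, j). a (Suc i) j)) =
      (\<Sum>p | p permutes {0..<k}. signof p * (\<Prod>i<k. a (Suc i) (p i)))"
  proof -
    have "(\<Prod>i = 0..<k. mat k k (\<lambda>(i, j). a (Suc i) j) $$ (i, p i)) = (\<Prod>i<k. a (Suc i) (p i))"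
      if p: "p permutes {0..<k}" for p
      unfolding atLeast0LessThan
    proof (rule prod.cong[OF refl])
      fix i assume "i \<in> {..<k}"
      then show "mat k k (\<lambda>(i, j). a (Suc i) j) $$ (i, p i) = a (Suc i) (p i)"
        using permutes_in_image[OF p, of i] by simp
    qed
    then show ?thesis by (simp add: det_def)
  qed
  ultimately have "CT (S * det ?b * det (mat k k (\<lambda>(i, j). a (Suc i) j))) =
      (\<Sum>p | p permutes {0..<k}. CT ?t)"
    by (simp add: sum_distrib_left CT_sum)
  also have "\<dots> = fact k * CT ?t"
    using card_permutations[of "{0..<k}" k] by simp
  finally show ?thesis .
qed

section \<open>The constant term of $Q$\<close>

lemma prod_atLeast1_atMost: "(\<Prod>i=1..k. f i) = (\<Prod>i<k. f (Suc i) :: 'a::comm_monoid_mult)"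
  by (simp add: prod.atLeast1_atMost_eq)

text \<open>The two ratios belonging to an unordered pair join the factor 1/(1 - x_i x_j) in
  \<open>pair_factor\<close>. The denominator may be inverted factor by factor because all its
  factors are units.\<close>

lemma Q_series_eq: "Q_series n P = littlewood_kernel {1..n} * subst_poly P var_inv"
proof -
  let ?D = "{(i, j). i \<in> {1..n} \<and> j \<in> {1..n} \<and> i < j}"
  let ?f = "\<lambda>(i, j). 1 - var i * var_inv j :: rat laurent"
  have fin: "finite ?D" by (rule finite_subset[of _ "{1..n} \<times> {1..n}"]) auto
  have "{(i, j). i \<in> {1..n} \<and> j \<in> {1..n} \<and> i \<noteq> j} = ?D \<union> prod.swap ` ?D" by (auto simp: image_iff)
  then have "prod ?f {(i, j). i \<in> {1..n} \<and> j \<in> {1..n} \<and> i \<noteq> j} = prod ?f ?D * prod ?f (prod.swap ` ?D)"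
    using fin by (simp only:) (subst prod.union_disjoint, auto)
  also have "prod ?f (prod.swap ` ?D) = (\<Prod>(i, j)\<in>?D. 1 - var j * var_inv i)"
    by (subst prod.reindex) (auto simp: inj_on_def intro!: prod.cong)
  finally have num: "prod ?f {(i, j). i \<in> {1..n} \<and> j \<in> {1..n} \<and> i \<noteq> j} =
      (\<Prod>(i, j)\<in>?D. (1 - var i * var_inv j) * (1 - var j * var_inv i))"
    by (simp add: prod.distrib case_prod_unfold)
  have D: "{(i, j). 1 \<le> i \<and> i < j \<and> j \<le> n} = ?D" by auto
  have den1: "inverse (\<Prod>i=1..n. 1 - var i) = (\<Prod>i=1..n. inverse (1 - var i :: rat laurent)) \<and>
      (\<Prod>i=1..n. 1 - var i) * inverse (\<Prod>i=1..n. 1 - var i :: rat laurent) = 1"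
    by (rule laurent_inverse_prod) simp
  let ?g = "\<lambda>(i, j). 1 - var i * var j :: rat laurent"
  have den2: "inverse (prod ?g ?D) = (\<Prod>p\<in>?D. inverse (?g p)) \<and> prod ?g ?D * inverse (prod ?g ?D) = 1"
    by (rule laurent_inverse_prod) (auto simp: case_prod_unfold)
  have "Q_series n P = prod ?f {(i, j). i \<in> {1..n} \<and> j \<in> {1..n} \<and> i \<noteq> j} * subst_poly P var_inv *
      ((\<Prod>i=1..n. inverse (1 - var i)) * (\<Prod>p\<in>?D. inverse (?g p)))"
    unfolding Q_series_def divide_laurent_def D
    by (simp only: laurent_inverse_mult[OF conjunct2[OF den1] conjunct2[OF den2]] conjunct1[OF den1] conjunct1[OF den2])
  also have "\<dots> = littlewood_kernel {1..n} * subst_poly P var_inv"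
    unfolding num littlewood_kernel_def pair_factor_def
    by (simp add: prod.distrib case_prod_unfold mult_ac)
  finally show ?thesis .
qed

lemma rename_vars_symmetric_subst_var_inv:
  assumes "symmetric_poly n P" "i \<in> {1..n}" "j \<in> {1..n}"
  shows "rename_vars (Transposition.transpose i j) (subst_poly P var_inv) = subst_poly P var_inv"
  using symmetric_poly_subst_permute[OF assms(1) permutes_swap_id[OF assms(2,3)], of var_inv]
  by (simp add: rename_vars_subst_poly)

text \<open>Renaming moves x_i and its inverse together and leaves the entry 1 in place. On indices
  this is the permutation \<open>lift \<pi>\<close> of 1..n, under which the symmetric P is
  invariant.\<close>

lemma rename_vars_subst_paired_point:
  assumes P: "symmetric_poly n P" and n: "n = 2 * k \<or> n = 2 * k + 1" and \<pi>: "\<pi> permutes {1..k}"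
  shows "rename_vars \<pi> (subst_poly P (paired_point k)) = subst_poly P (paired_point k)"
proof -
  define lift where "lift \<pi> i = (if i \<le> k then \<pi> i else if i \<le> 2 * k then k + \<pi> (i - k) else i)" for \<pi> :: "nat \<Rightarrow> nat" and i
  have bij: "bij \<pi>" using \<pi> by (rule permutes_bij)
  have in_image: "\<sigma> i \<in> {1..k} \<longleftrightarrow> i \<in> {1..k}" if "\<sigma> permutes {1..k}" for \<sigma> i
    by (rule permutes_in_image[OF that])
  have lift_le: "lift \<sigma> i \<in> {1..k}" if "\<sigma> permutes {1..k}" "i \<in> {1..k}" for \<sigma> i
    using in_image[OF that(1), of i] that(2) by (simp add: lift_def)
  have lift_mid: "lift \<sigma> i \<in> {k + 1..2 * k}" if "\<sigma> permutes {1..k}" "i \<in> {k + 1..2 * k}" for \<sigma> i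
  proof -
    have "i - k \<in> {1..k}" using that(2) by auto
    then have "\<sigma> (i - k) \<in> {1..k}" using in_image[OF that(1)] by blast
    then show ?thesis using that(2) by (auto simp: lift_def)
  qed
  have lift_lift: "lift \<sigma> (lift \<tau> i) = i"
    if "\<sigma> permutes {1..k}" "\<tau> permutes {1..k}" "\<And>i. \<sigma> (\<tau> i) = i" and i: "i \<in> {1..n}" for \<sigma> \<tau> i
  proof -
    consider "i \<in> {1..k}" | "i \<in> {k + 1..2 * k}" | "i > 2 * k" using i by fastforce
    then show ?thesis
    proof cases
      case 1
      then show ?thesis using lift_le[OF that(2) 1] that(3) by (auto simp: lift_def)
    next
      case 2
      then have "lift \<tau> i = k + \<tau> (i - k)" by (auto simp: lift_def)
      then show ?thesis using lift_mid[OF that(2) 2] that(3)[of "i - k"] 2 by (auto simp: lift_def)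
    qed (auto simp: lift_def)
  qed
  have lift_in: "lift \<sigma> i \<in> {1..n}" if \<sigma>: "\<sigma> permutes {1..k}" and i: "i \<in> {1..n}" for \<sigma> i
  proof -
    consider "i \<in> {1..k}" | "i \<in> {k + 1..2 * k}" | "i > 2 * k" using i by fastforce
    then show ?thesis
    proof cases
      case 1
      show ?thesis using lift_le[OF \<sigma> 1] n by auto
    next
      case 2
      show ?thesis using lift_mid[OF \<sigma> 2] n by auto
    qed (use i in \<open>auto simp: lift_def\<close>)
  qed
  note inv = permutes_inv[OF \<pi>]
  let ?\<pi>' = "\<lambda>i. if i \<in> {1..n} then lift \<pi> i else i"
  have "bij_betw ?\<pi>' {1..n} {1..n}"
  proof (rule bij_betw_byWitness[where f' = "lift (Hilbert_Choice.inv \<pi>)"])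
    show "\<forall>a\<in>{1..n}. lift (Hilbert_Choice.inv \<pi>) (?\<pi>' a) = a"
      using lift_lift[OF inv \<pi>] permutes_inverses(2)[OF \<pi>] by simp
    show "\<forall>a\<in>{1..n}. ?\<pi>' (lift (Hilbert_Choice.inv \<pi>) a) = a"
      using lift_lift[OF \<pi> inv] lift_in[OF inv] permutes_inverses(1)[OF \<pi>] by simp
    show "?\<pi>' ` {1..n} \<subseteq> {1..n}" "lift (Hilbert_Choice.inv \<pi>) ` {1..n} \<subseteq> {1..n}"
      using lift_in[OF \<pi>] lift_in[OF inv] by (auto simp del: atLeastAtMost_iff)
  qed
  then have perm: "?\<pi>' permutes {1..n}" by (rule bij_imp_permutes) auto
  have "rename_vars \<pi> (subst_poly P (paired_point k)) = subst_poly P (\<lambda>i. rename_vars \<pi> (paired_point k i))"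
    by (rule rename_vars_subst_poly[OF bij])
  also have "\<dots> = subst_poly P (\<lambda>i. paired_point k (?\<pi>' i))"
  proof (rule subst_poly_cong)
    fix m i assume "m \<in> Poly_Mapping.keys P" "i \<in> Poly_Mapping.keys m"
    then have i: "i \<in> {1..n}" using P unfolding symmetric_poly_def by blast
    consider "i \<in> {1..k}" | "i \<in> {k + 1..2 * k}" | "i > 2 * k" using i by fastforce
    then show "rename_vars \<pi> (paired_point k i) = paired_point k (?\<pi>' i)"
    proof cases
      case 1
      then show ?thesis using lift_le[OF \<pi> 1] i bij by (auto simp: paired_point_def lift_def)
    next
      case 2
      then show ?thesis using lift_mid[OF \<pi> 2] i bij by (auto simp: paired_point_def lift_def)
    next
      case 3
      then show ?thesis using i bij by (auto simp: paired_point_def lift_def)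
    qed
  qed
  also have "\<dots> = subst_poly P (paired_point k)" by (rule symmetric_poly_subst_permute[OF P perm])
  finally show ?thesis .
qed

section \<open>Evaluation in the two parities\<close>

context
  fixes n k :: nat and P :: "(nat \<Rightarrow>\<^sub>0 nat) \<Rightarrow>\<^sub>0 rat"
  assumes P: "symmetric_poly n P"
begin

lemma subst_symmetric_poly_cong: "(\<And>i. i \<in> {1..n} \<Longrightarrow> y i = z i) \<Longrightarrow> subst_poly P y = subst_poly P z"
  using P unfolding symmetric_poly_def by (intro subst_poly_cong) blast

lemma CT_Q_series_even:
  assumes n: "n = 2 * k"
  shows "CT (Q_series n P) = of_nat (double_fact (2 * k - 1)) *
    CT (subst_poly P (paired_point k) * Bbar_det k ^ 2 * (\<Prod>i = 1..k. var i))"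
proof -
  \<comment> \<open>P involves no variable beyond n, so the points may be set to 1 elsewhere, as the
    specialization demands.\<close>
  let ?y = "\<lambda>i. if i \<in> {1..2 * k} then var_inv i else 1 :: rat laurent"
  let ?z = "\<lambda>i. if i \<in> {1..2 * k} then paired_point k i else 1"
  have y: "subst_poly P ?y = subst_poly P var_inv" by (rule subst_symmetric_poly_cong) (simp add: n)
  have z: "subst_poly P ?z = subst_poly P (paired_point k)" by (rule subst_symmetric_poly_cong) (simp add: n)
  have "CT (littlewood_kernel {1..2 * k} * (subst_poly P ?y * 1)) = of_nat (double_fact (2 * k - 1)) *
      CT (subst_poly P ?z * (\<Prod>i=1..k. (1 + var i) * (1 + var_inv i)) * (discriminant k)\<^sup>2)"
  proof (rule CT_littlewood_kernel_specialization[where s = 1])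
    show "rename_vars (Transposition.transpose i j) (subst_poly P ?y * 1) = subst_poly P ?y * 1"
      if "i \<in> {1..2 * k}" "j \<in> {1..2 * k}" for i j
      using rename_vars_symmetric_subst_var_inv[OF P] that unfolding y mult_1_right n by blast
  qed (auto simp: laurent_in_1 paired_point_def)
  moreover have "(\<Prod>i=1..k. (1 + var i) * (1 + var_inv i)) * (discriminant k)\<^sup>2 =
      Bbar_det k ^ 2 * (\<Prod>i = 1..k. var i)"
  proof -
    \<comment> \<open>The weight is x_i times a square, and the root of the square is the row factor
      of \<open>Bbar_det\<close>.\<close>
    have "(1 + var i) * (1 + var_inv i) = (1 + var_inv i)\<^sup>2 * (var i :: rat laurent)" for i
    proof -
      have "(1 + var_inv i)\<^sup>2 * (var i :: rat laurent) = (1 + var_inv i) * (var i + var_inv i * var i)"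
        by (simp only: power2_eq_square algebra_simps mult_1_left)
      then show ?thesis by (simp add: algebra_simps)
    qed
    then have "(\<Prod>i=1..k. (1 + var i) * (1 + var_inv i)) =
        (\<Prod>i=1..k. 1 + var_inv i)\<^sup>2 * (\<Prod>i=1..k. var i :: rat laurent)"
      by (simp only: prod.distrib prod_power_distrib)
    moreover have "(\<Prod>i<k. 1 + var_inv (Suc i)) = (\<Prod>i=1..k. 1 + var_inv i :: rat laurent)"
      by (rule prod_atLeast1_atMost[symmetric])
    ultimately show ?thesis unfolding Bbar_det_eq by (simp only: power_mult_distrib mult_ac)
  qed
  ultimately show ?thesis unfolding Q_series_eq n y z mult_1_right by (simp only: mult.assoc)
qed

lemma CT_Q_series_odd:
  assumes n: "n = 2 * k + 1"
  shows "CT (Q_series n P) = (- 1) ^ k * of_nat (double_fact (2 * k + 1)) *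
    CT (subst_poly P (paired_point k) * B_det k ^ 2)"
proof -
  let ?y = "\<lambda>i. if i \<in> {1..2 * k + 1} then var_inv i else 1 :: rat laurent"
  let ?z = "\<lambda>i. if i \<in> {1..2 * k} then paired_point k i else 1"
  let ?q = "inverse (1 - var n) :: rat laurent"
  \<comment> \<open>The cross factors between x_n and the other variables, as a polynomial so that
    they can be specialized along with P.\<close>
  define V where "V = (\<Prod>l=1..2 * k. poly_var n - poly_var l :: (nat \<Rightarrow>\<^sub>0 nat) \<Rightarrow>\<^sub>0 rat)"
  have V: "subst_poly V x = (\<Prod>l=1..2 * k. x n - x l)" for x
    by (simp add: V_def subst_hom.hom_prod subst_hom.hom_minus)
  have y: "subst_poly P ?y = subst_poly P var_inv" by (rule subst_symmetric_poly_cong) (simp add: n)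
  have z: "subst_poly P ?z = subst_poly P (paired_point k)"
    by (rule subst_symmetric_poly_cong) (auto simp: n paired_point_def)
  have Vy: "subst_poly V ?y = (\<Prod>l=1..2 * k. var_inv n - var_inv l)"
    unfolding V by (rule prod.cong) (auto simp: n)
  have minus_n: "{1..n} - {n} = {1..2 * k}" by (auto simp: n)
  have "CT (Q_series n P) = of_nat n * CT (peel_one {1..n} n * subst_poly P var_inv)"
    unfolding Q_series_eq
    using CT_littlewood_kernel_peel_one[of "{1..n}" n "subst_poly P var_inv"]
      rename_vars_symmetric_subst_var_inv[OF P] by (simp add: n)
  also have "peel_one {1..n} n * subst_poly P var_inv = littlewood_kernel {1..2 * k} * (subst_poly (P * V) ?y * ?q)"
    unfolding peel_one_def minus_n subst_poly_mult Vy y by (simp only: mult_ac)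
  also have "CT \<dots> = of_nat (double_fact (2 * k - 1)) *
      CT (subst_poly (P * V) ?z * (\<Prod>i=1..k. (1 + var i) * (1 + var_inv i)) * (discriminant k)\<^sup>2)"
  proof (rule CT_littlewood_kernel_specialization[where s = "var_inv n"])
    \<comment> \<open>All coefficients of 1/(1 - x_n) at nonnegative powers are 1: the functional
      evaluates 1/x_n at 1.\<close>
    show "CT (var_inv n ^ e * ?q) = 1" for e
      using CT_var_inv_powers_mult[of n e n 0 ?q] by (auto simp: coeff_inverse_one_minus_var)
    show "rename_vars (Transposition.transpose i j) (subst_poly (P * V) ?y * ?q) = subst_poly (P * V) ?y * ?q"
      if ij: "i \<in> {1..2 * k}" "j \<in> {1..2 * k}" for i j
    proof -
      have fixed: "Transposition.transpose i j n = n" using ij n by (auto simp: Transposition.transpose_def)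
      have "rename_vars (Transposition.transpose i j) (subst_poly V ?y) = subst_poly V ?y"
        unfolding Vy by (rule rename_vars_transpose_prod[OF ij]) (simp add: rename_vars_diff fixed)
      moreover have "rename_vars (Transposition.transpose i j) (subst_poly P ?y) = subst_poly P ?y"
        unfolding y using ij n by (intro rename_vars_symmetric_subst_var_inv[OF P]) auto
      moreover have "rename_vars (Transposition.transpose i j) ?q = ?q" by (simp add: fixed)
      ultimately show ?thesis by (simp only: subst_poly_mult rename_vars_mult[OF bij_transpose])
    qed
  qed (auto simp: n paired_point_def intro!: laurent_in_intros)
  also have "subst_poly (P * V) ?z * (\<Prod>i=1..k. (1 + var i) * (1 + var_inv i)) * (discriminant k)\<^sup>2 =
      (- 1) ^ k * (subst_poly P (paired_point k) * B_det k ^ 2)"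
  proof -
    \<comment> \<open>\<open>?z n\<close> = 1 supplies the 1 in 1 - \<open>?z l\<close>. The dummy
      factor at l = n extends the range to 2k+1, as \<open>prod_double_interval\<close>
      needs.\<close>
    have "subst_poly V ?z = (\<Prod>l=1..2 * k + 1. if l = n then 1 else 1 - ?z l)"
      unfolding V by (simp add: n)
    also have "\<dots> = (\<Prod>i=1..k. (1 - var i) * (1 - var_inv i))"
      unfolding prod_double_interval n
      by (simp only: if_True mult_1_right simp_thms) (rule prod.cong, auto simp: paired_point_def)
    finally have Vz: "subst_poly V ?z = (\<Prod>i=1..k. (1 - var i) * (1 - var_inv i))" .
    \<comment> \<open>The left side is (1 - x^2)(1 - x^(-2)); the minus sign on the right is the
      origin of (-1)^k.\<close>
    have "(1 - var i) * (1 - var_inv i) * ((1 + var i) * (1 + var_inv i)) = - 1 * (var_inv i - var i :: rat laurent)\<^sup>2" for i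
    proof -
      have "(1 - var i) * (1 - var_inv i) * ((1 + var i) * (1 + var_inv i)) =
          1 - var i * var i - var_inv i * var_inv i + (var i * var_inv i) * (var i * var_inv i :: rat laurent)"
        by (simp only: algebra_simps mult_1_left mult_1_right)
      moreover have "- 1 * (var_inv i - var i :: rat laurent)\<^sup>2 =
          (var i * var_inv i) + (var i * var_inv i) - var i * var i - var_inv i * var_inv i"
        by (simp only: power2_eq_square algebra_simps mult_1_left mult_1_right) simp
      ultimately show ?thesis by simp
    qed
    then have "subst_poly V ?z * (\<Prod>i=1..k. (1 + var i) * (1 + var_inv i)) =
        (- 1) ^ k * (\<Prod>i=1..k. var_inv i - var i)\<^sup>2"
      unfolding Vz prod.distrib[symmetric] prod_power_distrib by (simp only: prod.distrib) simp
    moreover have "(\<Prod>i<k. var_inv (Suc i) - var (Suc i)) = (\<Prod>i=1..k. var_inv i - var i :: rat laurent)"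
      by (rule prod_atLeast1_atMost[symmetric])
    ultimately have "subst_poly V ?z * (\<Prod>i=1..k. (1 + var i) * (1 + var_inv i)) * (discriminant k)\<^sup>2 =
        (- 1) ^ k * B_det k ^ 2"
      unfolding B_det_eq power_mult_distrib by (simp only: mult.assoc)
    then have "subst_poly P ?z * (subst_poly V ?z * (\<Prod>i=1..k. (1 + var i) * (1 + var_inv i)) * (discriminant k)\<^sup>2) =
        subst_poly P (paired_point k) * ((- 1) ^ k * B_det k ^ 2)"
      unfolding z by (rule arg_cong)
    then show ?thesis unfolding subst_poly_mult by (simp only: mult_ac)
  qed
  also have "CT \<dots> = (- 1) ^ k * CT (subst_poly P (paired_point k) * B_det k ^ 2)"
    by (rule CT_power_neg_one_mult)
  moreover have "double_fact (2 * k + 1) = n * double_fact (2 * k - 1)"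
    using double_fact_odd[of k] by (simp add: n)
  ultimately show ?thesis by (simp only: of_nat_mult mult_ac)
qed

end

theorem theorem3:
  fixes n :: nat and P :: "(nat \<Rightarrow>\<^sub>0 nat) \<Rightarrow>\<^sub>0 rat"
  assumes "n \<ge> 1" and "symmetric_poly n P"
  shows "(\<forall>k. n = 2 * k \<longrightarrow>
      CT (Q_series n P) = fact (2 * k) / 2 ^ k *
          CT (subst_poly P (paired_point k) * Bbar_det k *
              (\<Prod>i = 1..k. var i powi int i + var i powi (1 - int i))) \<and>
      CT (Q_series n P) = of_nat (double_fact (2 * k - 1)) *
          CT (subst_poly P (paired_point k) * Bbar_det k ^ 2 * (\<Prod>i = 1..k. var i)))
    \<and> (\<forall>k. n = 2 * k + 1 \<longrightarrow>
      CT (Q_series n P) = fact (2 * k + 1) / (- 2) ^ k *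
          CT (subst_poly P (paired_point k) * B_det k *
              (\<Prod>i = 1..k. var i powi (- int i) - var i powi int i)) \<and>
      CT (Q_series n P) = (- 1) ^ k * of_nat (double_fact (2 * k + 1)) *
          CT (subst_poly P (paired_point k) * B_det k ^ 2))"
proof (intro conjI[where P = "\<forall>k. _ k"] allI impI)
  fix k assume n: "n = 2 * k"
  let ?S = "subst_poly P (paired_point k)"
  \<comment> \<open>The product of the x_i is distributed over the rows of one of the two
    determinants. The diagonal entries of that matrix are then the factors x_i^i +
    x_i^(1-i).\<close>
  define a b :: "nat \<Rightarrow> nat \<Rightarrow> rat laurent"
    where "a i j = var i * b i j" and "b i j = var i ^ j + var_inv i ^ Suc j" for i j
  have b: "Bbar_det k = det (mat k k (\<lambda>(i, j). b (Suc i) j))"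
    unfolding Bbar_det_def b_def by (simp only: var_powi Suc_eq_plus1)
  have "det (mat k k (\<lambda>(i, j). a (Suc i) j)) = (\<Prod>i = 1..k. var i) * Bbar_det k"
    unfolding a_def b det_scale_rows by (simp only: prod_atLeast1_atMost)
  then have "?S * Bbar_det k ^ 2 * (\<Prod>i = 1..k. var i) =
      ?S * det (mat k k (\<lambda>(i, j). b (Suc i) j)) * det (mat k k (\<lambda>(i, j). a (Suc i) j))"
    unfolding b[symmetric] power2_eq_square by (simp only: mult_ac)
  also have "CT \<dots> = fact k * CT (?S * Bbar_det k * (\<Prod>i<k. a (Suc i) i))"
    unfolding b using assms(2) n
    by (intro CT_mult_det_mult_det rename_vars_subst_paired_point)
      (auto simp: a_def b_def rename_vars_mult rename_vars_add rename_vars_power)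
  also have "(\<Prod>i<k. a (Suc i) i) = (\<Prod>i = 1..k. var i powi int i + var i powi (1 - int i))"
  proof -
    have "a (Suc i) i = var (Suc i) powi int (Suc i) + var (Suc i) powi (1 - int (Suc i))" for i
    proof -
      have "a (Suc i) i = var (Suc i) ^ Suc i + (var (Suc i) * var_inv (Suc i)) * var_inv (Suc i) ^ i"
        by (simp only: a_def b_def distrib_left power_Suc mult.assoc)
      then show ?thesis unfolding Suc_eq_plus1 var_powi by simp
    qed
    then show ?thesis by (simp only: prod_atLeast1_atMost)
  qed
  finally have "CT (?S * Bbar_det k ^ 2 * (\<Prod>i = 1..k. var i)) = fact k *
      CT (?S * Bbar_det k * (\<Prod>i = 1..k. var i powi int i + var i powi (1 - int i)))" .
  \<comment> \<open>Dividing by 2^k leaves k! (2k-1)!!, whose k! is the number of Leibniz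
    terms.\<close>
  moreover have "fact (2 * k) = (2 ^ k * fact k * of_nat (double_fact (2 * k - 1)) :: rat)"
    using arg_cong[OF fact_double[of k], of "of_nat :: nat \<Rightarrow> rat"] by simp
  moreover note CT_Q_series_even[OF assms(2) n]
  ultimately show "CT (Q_series n P) = fact (2 * k) / 2 ^ k *
          CT (?S * Bbar_det k * (\<Prod>i = 1..k. var i powi int i + var i powi (1 - int i))) \<and>
      CT (Q_series n P) = of_nat (double_fact (2 * k - 1)) * CT (?S * Bbar_det k ^ 2 * (\<Prod>i = 1..k. var i))"
    by (simp only:) simp
next
  fix k assume n: "n = 2 * k + 1"
  let ?S = "subst_poly P (paired_point k)"
  define b :: "nat \<Rightarrow> nat \<Rightarrow> rat laurent" where "b i j = var_inv i ^ Suc j - var i ^ Suc j" for i j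
  have b: "B_det k = det (mat k k (\<lambda>(i, j). b (Suc i) j))"
    unfolding B_det_def b_def by (simp only: var_powi Suc_eq_plus1)
  have "?S * B_det k ^ 2 = ?S * det (mat k k (\<lambda>(i, j). b (Suc i) j)) * det (mat k k (\<lambda>(i, j). b (Suc i) j))"
    unfolding b[symmetric] power2_eq_square by (simp only: mult_ac)
  also have "CT \<dots> = fact k * CT (?S * B_det k * (\<Prod>i<k. b (Suc i) i))"
    unfolding b using assms(2) n
    by (intro CT_mult_det_mult_det rename_vars_subst_paired_point)
      (auto simp: b_def rename_vars_mult rename_vars_diff rename_vars_power)
  also have "(\<Prod>i<k. b (Suc i) i) = (\<Prod>i = 1..k. var i powi (- int i) - var i powi int i)"
    by (simp only: prod_atLeast1_atMost b_def var_powi)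
  finally have "CT (?S * B_det k ^ 2) = fact k *
      CT (?S * B_det k * (\<Prod>i = 1..k. var i powi (- int i) - var i powi int i))" .
  moreover have "fact (2 * k + 1) = (2 ^ k * fact k * of_nat (double_fact (2 * k + 1)) :: rat)"
    using arg_cong[OF fact_double[of k], of "of_nat :: nat \<Rightarrow> rat"] double_fact_odd[of k]
    by (simp add: algebra_simps)
  moreover note CT_Q_series_odd[OF assms(2) n]
  moreover have "(- 2 :: rat) ^ k = (- 1) ^ k * 2 ^ k" by (simp flip: power_mult_distrib)
  \<comment> \<open>(-1)^k is its own inverse, so the division by (-2)^k produces the sign of the
    form with the squared determinant.\<close>
  moreover have "(1 :: rat) / (- 1) ^ k = (- 1) ^ k" by (cases "even k") auto
  ultimately show "CT (Q_series n P) = fact (2 * k + 1) / (- 2) ^ k *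
          CT (?S * B_det k * (\<Prod>i = 1..k. var i powi (- int i) - var i powi int i)) \<and>
      CT (Q_series n P) = (- 1) ^ k * of_nat (double_fact (2 * k + 1)) * CT (?S * B_det k ^ 2)"
    by (simp add: field_simps)
qed

end
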